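(* Let $G$ be a connected plane undirected graph with at least one edge, let $G^*$ be its planar dual, and take the trinity associated to $G$, so that $\mathrm{Pic}^0(D_V)=\mathrm{Pic}^0(G)$ and $\mathrm{Pic}^0(D_R)=\mathrm{Pic}^0(G^* )$. Then the isomorphism $\varphi_{V\to R}\colon\mathrm{Pic}^0(D_V)\to\mathrm{Pic}^0(D_R)$ agrees with the isomorphism $i\colon\mathrm{Pic}^0(G)\to\mathrm{Pic}^0(G^* )$.
   Context: Graphs may have loops and multiple edges. The positive orientation of the plane (or sphere) is counterclockwise, the negative one is clockwise. Trinities. A trinity is a triangulation of the oriented sphere $S^2$ (multiple edges between the same two points are allowed) together with a coloring of its points with three colors, red, emerald and violet, such that points joined by an edge have different colors. The sets of red, emerald and violet points are $R$, $E$, $V$. Each edge is colored with the color not occurring among its ends. A triangle is white if its red, emerald and violet nodes follow each other in clockwise order, and black otherwise; triangles sharing an edge have different colors. $D_V$ is the digraph on $V$ having, for each violet edge, one directed edge from the violet node of the black triangle containing it to the violet node of the white triangle containing it. $D_R$ is defined analogously on $R$ using red edges. Trinity of a plane graph $G$: $V$ is the vertex set of $G$; each edge of $G$ is subdivided by an emerald node (so $E$ is identified with the edge set of $G$); a red node is placed in each region of $G$ (so $R$ is the vertex set of $G^*$) and, traversing the boundary of its region, is connected at each corner to the emerald or violet node there. Then $D_V$ and $D_R$ are obtained from $G$ and $G^*$ by replacing each edge with two oppositely directed edges. Sandpile groups. For an Eulerian digraph $D$ with vertex set $W$, $\mathrm{Div}(D)=\mathbb{Z}^W$, and $\mathrm{Div}^0(D)$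 is the subgroup of vectors with coordinate sum $0$. Let $d(u,v)$ be the number of edges from $u$ to $v$ and $d^+(v)$ the outdegree. $L_D$ has entries $L_D(u,v)=d(v,u)$ for $u\ne v$ and $L_D(v,v)=d(v,v)-d^+(v)$. Write $x\sim y$ if $y=x+L_Dz$ for some $z\in\mathbb{Z}^W$; $[x]$ is the class of $x$; $\mathrm{Pic}^0(D)=\mathrm{Div}^0(D)/\sim$. For an undirected graph, these notions are applied to the digraph obtained by replacing each edge with two oppositely directed edges. The map $\varphi_{V\to R}$. $\mathcal{A}$ is the free Abelian group on $V\cup E\cup R$, with elements written as triples $(x_V,x_E,x_R)$. Two elements of $\mathcal{A}$ are white triangle equivalent ($\approx_W$) if their difference is an integer linear combination of characteristic vectors of white triangles. $\varphi_{V\to R}([x])=[y]$, where $x\in\mathrm{Div}^0(D_V)$, $y\in\mathrm{Div}^0(D_R)$ and $(x,\mathbf{0},\mathbf{0})\approx_W(\mathbf{0},\mathbf{0},-y)$; this is a well-defined isomorphism $\mathrm{Pic}^0(D_V)\to\mathrm{Pic}^0(D_R)$. The map $i$. Fix an orientation $\overrightarrow{e}$ of each edge $e$ of $G$. Orient the dual edge $e^*$ of $G^*$ so that $\overrightarrow{e}$ has to be turned in the negative (clockwise) direction to get the orientation of $\overrightarrow{e}^*$. For an oriented edge $\overrightarrow{e}$ let $\delta_{\overrightarrow{e}}$ be the vector equal to the indicator vector of its head minus the indicator vector of its tail (in $\mathbb{Z}^{V}$, and similarly $\delta_{\overrightarrow{e}^*}\in\mathbb{Z}^R$ for dual edges).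 For $g\in\mathrm{Div}^0(G)$ choose integers $a_{\overrightarrow{e}}$ with $\sum_{e}a_{\overrightarrow{e}}\delta_{\overrightarrow{e}}=g$ and set $i([g])=[\sum_e a_{\overrightarrow{e}}\delta_{\overrightarrow{e}^*}]$. This is a well-defined isomorphism, independent of the chosen orientation. *)

theory Defs
  imports
    "Graph_Theory.Graph_Theory"
    "HOL-Algebra.Free_Abelian_Groups"
    "HOL-Combinatorics.Orbits"
begin

section \<open>Plane graphs\<close>

text \<open>
  An undirected graph (loops and multiple edges allowed) is a bidirected digraph: every undirected
  edge is a pair of opposite arcs (\<^emph>\<open>darts\<close>) \<open>d\<close>, \<open>edge_rev M d\<close>. Its embedding in the oriented
  sphere is given combinatorially, by the rotation system: \<open>edge_succ M d\<close> is the next dart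
  after \<open>d\<close>, in counterclockwise direction, around the tail of \<open>d\<close>.
\<close>

record 'd pre_map =
  edge_rev :: "'d \<Rightarrow> 'd"
  edge_succ :: "'d \<Rightarrow> 'd"

definition edges :: "('v,'d) pre_digraph \<Rightarrow> 'd pre_map \<Rightarrow> 'd set set" where
  "edges G M = (\<lambda>d. {d, edge_rev M d}) ` arcs G"

text \<open>
  Going along \<open>d\<close> and leaving the head of \<open>d\<close> by the dart that follows \<open>edge_rev M d\<close>
  counterclockwise is the sharpest right turn. So the orbit of \<open>d\<close> under \<open>face_succ M\<close> is the
  boundary of the region to the right of \<open>d\<close>, traversed clockwise; regions are represented by
  these orbits.
\<close>

definition face_succ :: "'d pre_map \<Rightarrow> 'd \<Rightarrow> 'd" where
  "face_succ M d = edge_succ M (edge_rev M d)"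

definition face_of :: "'d pre_map \<Rightarrow> 'd \<Rightarrow> 'd set" where
  "face_of M d = orbit (face_succ M) d"

definition faces :: "('v,'d) pre_digraph \<Rightarrow> 'd pre_map \<Rightarrow> 'd set set" where
  "faces G M = face_of M ` arcs G"

text \<open>
  By Euler's formula the embedding of a connected graph given by a rotation system lies in the
  sphere. (The graph with a single vertex and no edges, whose only region has no boundary dart,
  does not satisfy the equation below.)
\<close>

locale connected_plane_graph =
  fin_digraph G + bidirected_digraph G "edge_rev M"
  for G :: "('v,'d) pre_digraph" and M :: "'d pre_map" +
  assumes edge_succ_permutes: "edge_succ M permutes arcs G"
    and edge_succ_cyclic:
      "\<And>v. v \<in> verts G \<Longrightarrow> out_arcs G v \<noteq> {} \<Longrightarrow> cyclic_on (edge_succ M) (out_arcs G v)"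
    and connected: "Digraph_Component.connected G"
    and sphere: "card (verts G) + card (faces G M) = card (edges G M) + 2"

text \<open>
  The dart dual to \<open>d\<close> is \<open>d\<close> turned clockwise, so it crosses \<open>d\<close> from left to right; it is
  represented by \<open>d\<close> itself.
\<close>

definition dual_graph :: "('v,'d) pre_digraph \<Rightarrow> 'd pre_map \<Rightarrow> ('d set,'d) pre_digraph" where
  "dual_graph G M =
    \<lparr>verts = faces G M, arcs = arcs G,
     tail = (\<lambda>d. face_of M (edge_rev M d)), head = face_of M\<rparr>"

section \<open>Sandpile groups\<close>

definition Div0 :: "('v,'d) pre_digraph \<Rightarrow> ('v \<Rightarrow>\<^sub>0 int) monoid" where
  "Div0 D = (free_Abelian_group (verts D))
     \<lparr>carrier := {x \<in> carrier (free_Abelian_group (verts D)).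
                    (\<Sum>w\<in>verts D. Poly_Mapping.lookup x w) = 0}\<rparr>"

definition num_arcs :: "('v,'d) pre_digraph \<Rightarrow> 'v \<Rightarrow> 'v \<Rightarrow> nat" where
  "num_arcs D u v = card {a \<in> arcs D. tail D a = u \<and> head D a = v}"

definition laplacian :: "('v,'d) pre_digraph \<Rightarrow> 'v \<Rightarrow> 'v \<Rightarrow> int" where
  "laplacian D u v =
    (if u = v then int (num_arcs D v v) - int (out_degree D v) else int (num_arcs D v u))"

definition laplacian_apply :: "('v,'d) pre_digraph \<Rightarrow> ('v \<Rightarrow> int) \<Rightarrow> ('v \<Rightarrow>\<^sub>0 int)" where
  "laplacian_apply D z =
    (\<Sum>u\<in>verts D. frag_cmul (\<Sum>v\<in>verts D. laplacian D u v * z v) (frag_of u))"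

definition principal :: "('v,'d) pre_digraph \<Rightarrow> ('v \<Rightarrow>\<^sub>0 int) set" where
  "principal D = range (laplacian_apply D)"

text \<open>Linear equivalence is the coset relation of the subgroup of principal divisors.\<close>

definition pic_class :: "('v,'d) pre_digraph \<Rightarrow> ('v \<Rightarrow>\<^sub>0 int) \<Rightarrow> ('v \<Rightarrow>\<^sub>0 int) set" where
  "pic_class D x = principal D #>\<^bsub>Div0 D\<^esub> x"

definition Pic0 :: "('v,'d) pre_digraph \<Rightarrow> ('v \<Rightarrow>\<^sub>0 int) set monoid" where
  "Pic0 D = Div0 D Mod principal D"

section \<open>Trinities\<close>

text \<open>
  A set of points colored with three colors is a set of elements of a disjoint sum. A trinity is
  a plane graph on such points, properly colored, all of whose regions are triangles.
\<close>

datatype color = Violet | Emerald | Red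

datatype ('v,'e,'r) node = V_node 'v | E_node 'e | R_node 'r

fun node_color :: "('v,'e,'r) node \<Rightarrow> color" where
  "node_color (V_node _) = Violet"
| "node_color (E_node _) = Emerald"
| "node_color (R_node _) = Red"

locale trinity =
  connected_plane_graph T N
  for T :: "(('v,'e,'r) node,'d) pre_digraph" and N :: "'d pre_map" +
  assumes properly_colored: "\<And>d. d \<in> arcs T \<Longrightarrow> node_color (tail T d) \<noteq> node_color (head T d)"
    and triangles: "\<And>t. t \<in> faces T N \<Longrightarrow> card t = 3"

definition colored_edges ::
    "(('v,'e,'r) node,'d) pre_digraph \<Rightarrow> 'd pre_map \<Rightarrow> color \<Rightarrow> 'd set set" where
  "colored_edges T N c = {k \<in> edges T N. \<forall>d\<in>k. node_color (tail T d) \<noteq> c}"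

text \<open>Recall that \<open>face_succ\<close> traverses a triangle clockwise.\<close>

definition white_triangles ::
    "(('v,'e,'r) node,'d) pre_digraph \<Rightarrow> 'd pre_map \<Rightarrow> 'd set set" where
  "white_triangles T N =
    {t \<in> faces T N. \<exists>d\<in>t. node_color (tail T d) = Red \<and>
       node_color (tail T (face_succ N d)) = Emerald \<and>
       node_color (tail T (face_succ N (face_succ N d))) = Violet}"

definition black_triangles ::
    "(('v,'e,'r) node,'d) pre_digraph \<Rightarrow> 'd pre_map \<Rightarrow> 'd set set" where
  "black_triangles T N = faces T N - white_triangles T N"

definition white_triangle_at ::
    "(('v,'e,'r) node,'d) pre_digraph \<Rightarrow> 'd pre_map \<Rightarrow> 'd set \<Rightarrow> 'd set" where
  "white_triangle_at T N k = (THE t. t \<in> white_triangles T N \<and> t \<inter> k \<noteq> {})"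

definition black_triangle_at ::
    "(('v,'e,'r) node,'d) pre_digraph \<Rightarrow> 'd pre_map \<Rightarrow> 'd set \<Rightarrow> 'd set" where
  "black_triangle_at T N k = (THE t. t \<in> black_triangles T N \<and> t \<inter> k \<noteq> {})"

definition violet_node :: "(('v,'e,'r) node,'d) pre_digraph \<Rightarrow> 'd set \<Rightarrow> 'v" where
  "violet_node T t = (THE v. V_node v \<in> tail T ` t)"

definition red_node :: "(('v,'e,'r) node,'d) pre_digraph \<Rightarrow> 'd set \<Rightarrow> 'r" where
  "red_node T t = (THE r. R_node r \<in> tail T ` t)"

definition D_V ::
    "(('v,'e,'r) node,'d) pre_digraph \<Rightarrow> 'd pre_map \<Rightarrow> ('v,'d set) pre_digraph" where
  "D_V T N =
    \<lparr>verts = {v. V_node v \<in> verts T}, arcs = colored_edges T N Violet,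
     tail = (\<lambda>k. violet_node T (black_triangle_at T N k)),
     head = (\<lambda>k. violet_node T (white_triangle_at T N k))\<rparr>"

definition D_R ::
    "(('v,'e,'r) node,'d) pre_digraph \<Rightarrow> 'd pre_map \<Rightarrow> ('r,'d set) pre_digraph" where
  "D_R T N =
    \<lparr>verts = {r. R_node r \<in> verts T}, arcs = colored_edges T N Red,
     tail = (\<lambda>k. red_node T (black_triangle_at T N k)),
     head = (\<lambda>k. red_node T (white_triangle_at T N k))\<rparr>"

text \<open>
  The free Abelian group on the points of \<open>T\<close> is \<open>free_Abelian_group (verts T)\<close>;
  \<open>triple x\<^sub>V x\<^sub>E x\<^sub>R\<close> is its element with the three given components.
\<close>

definition triple ::
    "('v \<Rightarrow>\<^sub>0 int) \<Rightarrow> ('e \<Rightarrow>\<^sub>0 int) \<Rightarrow> ('r \<Rightarrow>\<^sub>0 int) \<Rightarrow> (('v,'e,'r) node \<Rightarrow>\<^sub>0 int)" where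
  "triple x y z = frag_extend (frag_of \<circ> V_node) x + frag_extend (frag_of \<circ> E_node) y
     + frag_extend (frag_of \<circ> R_node) z"

definition white_triangle_equiv ::
    "(('v,'e,'r) node,'d) pre_digraph \<Rightarrow> 'd pre_map \<Rightarrow>
     (('v,'e,'r) node \<Rightarrow>\<^sub>0 int) \<Rightarrow> (('v,'e,'r) node \<Rightarrow>\<^sub>0 int) \<Rightarrow> bool" where
  "white_triangle_equiv T N p q \<longleftrightarrow>
    (\<exists>c. p - q = (\<Sum>t\<in>white_triangles T N. frag_cmul (c t) (\<Sum>n\<in>tail T ` t. frag_of n)))"

definition phi_VR ::
    "(('v,'e,'r) node,'d) pre_digraph \<Rightarrow> 'd pre_map \<Rightarrow> ('v \<Rightarrow>\<^sub>0 int) set \<Rightarrow> ('r \<Rightarrow>\<^sub>0 int) set" where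
  "phi_VR T N X = (THE Y. \<exists>x\<in>carrier (Div0 (D_V T N)). \<exists>y\<in>carrier (Div0 (D_R T N)).
     X = pic_class (D_V T N) x \<and> Y = pic_class (D_R T N) y \<and>
     white_triangle_equiv T N (triple x 0 0) (triple 0 0 (- y)))"

section \<open>The trinity of a plane graph\<close>

text \<open>
  Each dart \<open>d\<close> of \<open>G\<close> yields three edges of the trinity, each with two darts: the half of the
  edge of \<open>d\<close> at the tail of \<open>d\<close> (\<open>VE d\<close>, \<open>EV d\<close>), and the edges joining the red node of
  the region to the right of \<open>d\<close> to the tail of \<open>d\<close>, at the corner immediately to the right of
  \<open>d\<close> (\<open>VR d\<close>, \<open>RV d\<close>), and to the emerald node of \<open>d\<close>, on its right side
  (\<open>ER d\<close>, \<open>RE d\<close>).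
\<close>

datatype 'd tdart = VE 'd | EV 'd | VR 'd | RV 'd | ER 'd | RE 'd

fun trinity_rev :: "'d tdart \<Rightarrow> 'd tdart" where
  "trinity_rev (VE d) = EV d"
| "trinity_rev (EV d) = VE d"
| "trinity_rev (VR d) = RV d"
| "trinity_rev (RV d) = VR d"
| "trinity_rev (ER d) = RE d"
| "trinity_rev (RE d) = ER d"

fun trinity_tail ::
    "('v,'d) pre_digraph \<Rightarrow> 'd pre_map \<Rightarrow> 'd tdart \<Rightarrow> ('v,'d set,'d set) node" where
  "trinity_tail G M (VE d) = V_node (tail G d)"
| "trinity_tail G M (VR d) = V_node (tail G d)"
| "trinity_tail G M (EV d) = E_node {d, edge_rev M d}"
| "trinity_tail G M (ER d) = E_node {d, edge_rev M d}"
| "trinity_tail G M (RV d) = R_node (face_of M d)"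
| "trinity_tail G M (RE d) = R_node (face_of M d)"

text \<open>
  Counterclockwise order of the darts: around the tail of \<open>d\<close> it is
  \<open>VR d\<close>, \<open>VE d\<close>, \<open>VR d'\<close>, \<open>VE d'\<close>, and so on, with \<open>d' = edge_succ M d\<close>; around the emerald node
  of \<open>d\<close> it is \<open>EV d\<close>, \<open>ER d\<close>, \<open>EV d'\<close>, \<open>ER d'\<close> with \<open>d' = edge_rev M d\<close>; and around the red
  node of the region to the right of \<open>d\<close>, whose boundary is traversed clockwise by
  \<open>face_succ M\<close>, it is \<open>RE d\<close>, \<open>RV d\<close>, \<open>RE d'\<close>, \<open>RV d'\<close>, and so on, with \<open>d = face_succ M d'\<close>.
\<close>

fun trinity_succ :: "'d pre_map \<Rightarrow> 'd tdart \<Rightarrow> 'd tdart" where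
  "trinity_succ M (VR d) = VE d"
| "trinity_succ M (VE d) = VR (edge_succ M d)"
| "trinity_succ M (EV d) = ER d"
| "trinity_succ M (ER d) = EV (edge_rev M d)"
| "trinity_succ M (RE d) = RV d"
| "trinity_succ M (RV d) = RE (inv_into UNIV (face_succ M) d)"

definition trinity_graph ::
    "('v,'d) pre_digraph \<Rightarrow> 'd pre_map \<Rightarrow> (('v,'d set,'d set) node,'d tdart) pre_digraph" where
  "trinity_graph G M =
    \<lparr>verts = V_node ` verts G \<union> E_node ` edges G M \<union> R_node ` faces G M,
     arcs = (\<Union>d\<in>arcs G. {VE d, EV d, VR d, RV d, ER d, RE d}),
     tail = trinity_tail G M,
     head = (\<lambda>k. trinity_tail G M (trinity_rev k))\<rparr>"

definition trinity_map :: "('v,'d) pre_digraph \<Rightarrow> 'd pre_map \<Rightarrow> 'd tdart pre_map" where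
  "trinity_map G M =
    \<lparr>edge_rev = perm_restrict trinity_rev (arcs (trinity_graph G M)),
     edge_succ = perm_restrict (trinity_succ M) (arcs (trinity_graph G M))\<rparr>"

section \<open>The isomorphism given by planar duality\<close>

definition orientation :: "('v,'d) pre_digraph \<Rightarrow> 'd pre_map \<Rightarrow> 'd set \<Rightarrow> bool" where
  "orientation G M S \<longleftrightarrow> S \<subseteq> arcs G \<and> (\<forall>k\<in>edges G M. \<exists>!d. d \<in> k \<and> d \<in> S)"

definition delta :: "('v,'d) pre_digraph \<Rightarrow> 'd \<Rightarrow> ('v \<Rightarrow>\<^sub>0 int)" where
  "delta D d = frag_of (head D d) - frag_of (tail D d)"

definition dual_iso ::
    "('v,'d) pre_digraph \<Rightarrow> 'd pre_map \<Rightarrow> 'd set \<Rightarrow> ('v \<Rightarrow>\<^sub>0 int) set \<Rightarrow> ('d set \<Rightarrow>\<^sub>0 int) set" where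
  "dual_iso G M S X = (THE Y. \<exists>g\<in>carrier (Div0 G). \<exists>a.
     X = pic_class G g \<and> (\<Sum>d\<in>S. frag_cmul (a d) (delta G d)) = g \<and>
     Y = pic_class (dual_graph G M) (\<Sum>d\<in>S. frag_cmul (a d) (delta (dual_graph G M) d)))"

end

theory Submission
  imports Defs
begin

text \<open>
  Both isomorphisms are given by relations between divisors on \<open>V\<close> and divisors on \<open>R\<close>, and these
  two relations are equal. Fix one dart of each edge, so that \<open>G\<close> and its dual become digraphs \<open>D\<close>
  and \<open>D'\<close> with the same arcs. The map \<open>i\<close> relates the boundary in \<open>D\<close> of an integer chain to its
  boundary in \<open>D'\<close>. On the other side, each dart \<open>d\<close> of \<open>G\<close> has one white triangle, namely the one
  on its left at its tail, with nodes \<open>tail d\<close>, the edge of \<open>d\<close>, and the region on the left of \<open>d\<close>.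
  The emerald component of a combination of white triangles vanishes exactly when opposite darts have
  opposite coefficients. But for opposite darts the difference of the two triangles is, up to sign,
  the sum of the boundaries of \<open>d\<close> and of its dual. Hence \<open>(x,0,0)\<close> and \<open>(0,0,-y)\<close> are white
  triangle equivalent exactly when \<open>x\<close> and \<open>y\<close> are the two boundaries of a common chain
  (\<open>duality_relation_iff\<close>), and \<open>phi_VR\<close> coincides with \<open>dual_iso\<close> (\<open>phi_VR_eq_dual_iso\<close>).

  It remains to see that this relation induces an isomorphism of the Picard groups. Every divisor of
  degree \<open>0\<close> is a boundary because \<open>G\<close> and its dual are connected, and the principal divisors are the
  boundaries of coboundaries. So the point is that a chain has a principal boundary in \<open>D\<close> exactly
  when it has one in \<open>D'\<close>. This follows from the duality of cycles and cuts: coboundaries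
  of either digraph are cycles of the other, and conversely every cycle is a coboundary of the dual
  (\<open>cycle_is_dual_cut\<close>). For the converse, which needs the sphere, take a spanning tree of \<open>D\<close>; by
  Euler's formula its complement is a spanning tree of \<open>D'\<close>. Integrating a cycle along the second
  tree gives a potential on the regions whose coboundary agrees with the cycle off the first tree, and
  a cycle supported on a tree is zero.

  That the subdivision is a trinity, and that \<open>D_V\<close> and \<open>D_R\<close> have the same divisors and the same
  principal divisors as \<open>G\<close> and its dual, is read off from the list of its triangles: two for each
  dart of \<open>G\<close>, one black and one white.
\<close>

section \<open>Boundary and coboundary in a digraph\<close>

definition boundary :: "('v,'d) pre_digraph \<Rightarrow> ('d \<Rightarrow> int) \<Rightarrow> ('v \<Rightarrow>\<^sub>0 int)" where
  "boundary D a = (\<Sum>d\<in>arcs D. frag_cmul (a d) (delta D d))"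

definition coboundary :: "('v,'d) pre_digraph \<Rightarrow> ('v \<Rightarrow> int) \<Rightarrow> 'd \<Rightarrow> int" where
  "coboundary D z d = z (head D d) - z (tail D d)"

lemma boundary_cong: "(\<And>d. d \<in> arcs D \<Longrightarrow> a d = b d) \<Longrightarrow> boundary D a = boundary D b"
  by (simp add: boundary_def)

lemma boundary_add: "boundary D (\<lambda>d. a d + b d) = boundary D a + boundary D b"
  by (simp add: boundary_def frag_cmul_distrib sum.distrib)

lemma boundary_minus: "boundary D (\<lambda>d. - a d) = - boundary D a"
  by (simp add: boundary_def sum_negf flip: minus_frag_cmul)

lemma boundary_diff: "boundary D (\<lambda>d. a d - b d) = boundary D a - boundary D b"
  by (simp add: boundary_def frag_cmul_diff_distrib sum_subtractf)

lemma boundary_cmul: "boundary D (\<lambda>d. k * a d) = frag_cmul k (boundary D a)"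
  by (simp add: boundary_def frag_cmul_sum)

lemma boundary_zero: "boundary D (\<lambda>d. 0) = 0"
  by (simp add: boundary_def)

text \<open>
  Boundary and coboundary are adjoint. Testing a boundary against all functions on the vertices
  turns statements about formal sums into statements about integer sums over arcs.
\<close>

lemma (in fin_digraph) sum_boundary:
  "(\<Sum>v\<in>verts G. z v * Poly_Mapping.lookup (boundary G a) v)
     = (\<Sum>d\<in>arcs G. a d * coboundary G z d)"
proof -
  have "(\<Sum>v\<in>verts G. z v * Poly_Mapping.lookup (boundary G a) v)
      = (\<Sum>v\<in>verts G. \<Sum>d\<in>arcs G. a d * (z v * Poly_Mapping.lookup (delta G d) v))"
    by (simp add: boundary_def lookup_sum sum_distrib_left algebra_simps)
  also have "\<dots> = (\<Sum>d\<in>arcs G. a d * (\<Sum>v\<in>verts G. z v * Poly_Mapping.lookup (delta G d) v))"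
    by (subst sum.swap) (simp add: sum_distrib_left)
  also have "\<dots> = (\<Sum>d\<in>arcs G. a d * coboundary G z d)"
  proof (rule sum.cong[OF refl])
    fix d assume "d \<in> arcs G"
    then have "head G d \<in> verts G" "tail G d \<in> verts G" by auto
    then have "(\<Sum>v\<in>verts G. z v * Poly_Mapping.lookup (delta G d) v) = coboundary G z d"
      by (simp add: delta_def coboundary_def lookup_minus right_diff_distrib sum_subtractf
          mult.commute[of "z _"] of_bool_def[symmetric])
    then show "a d * (\<Sum>v\<in>verts G. z v * Poly_Mapping.lookup (delta G d) v) = a d * coboundary G z d"
      by simp
  qed
  finally show ?thesis .
qed

lemma (in wf_digraph) keys_boundary: "Poly_Mapping.keys (boundary G a) \<subseteq> verts G"
proof -
  have "boundary G a \<in> carrier (free_Abelian_group (verts G))"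
    unfolding boundary_def
  proof (rule sum_closed_free_Abelian_group)
    fix d assume "d \<in> arcs G"
    then have "Poly_Mapping.keys (delta G d) \<subseteq> verts G"
      unfolding delta_def using keys_diff[of "frag_of (head G d)" "frag_of (tail G d)"] by auto
    then show "frag_cmul (a d) (delta G d) \<in> carrier (free_Abelian_group (verts G))"
      using keys_cmul[of "a d" "delta G d"] by auto
  qed
  then show ?thesis by simp
qed

lemma (in fin_digraph) boundary_eq_0_iff:
  "boundary G a = 0 \<longleftrightarrow> (\<forall>z. (\<Sum>d\<in>arcs G. a d * coboundary G z d) = 0)"
proof
  assume "boundary G a = 0"
  then show "\<forall>z. (\<Sum>d\<in>arcs G. a d * coboundary G z d) = 0"
    by (simp flip: sum_boundary)
next
  assume *: "\<forall>z. (\<Sum>d\<in>arcs G. a d * coboundary G z d) = 0"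
  show "boundary G a = 0"
  proof (rule poly_mapping_eqI)
    fix v
    show "Poly_Mapping.lookup (boundary G a) v = Poly_Mapping.lookup 0 v"
    proof (cases "v \<in> verts G")
      case True
      have "(\<Sum>u\<in>verts G. of_bool (u = v) * Poly_Mapping.lookup (boundary G a) u) = 0"
        using * by (simp only: sum_boundary)
      then show ?thesis using True by simp
    next
      case False
      then show ?thesis using keys_boundary[of a] by (auto simp: in_keys_iff)
    qed
  qed
qed

text \<open>
  In this form connectivity can be used for a set of vertices that is not defined by walks, and it
  can be checked for a graph whose walks are hard to describe, like the complement of a tree in the
  dual graph.
\<close>

lemma (in wf_digraph) connected_iff_cuts:
  "Digraph_Component.connected G \<longleftrightarrow> verts G \<noteq> {} \<and>
    (\<forall>U\<subseteq>verts G. U \<noteq> {} \<longrightarrow> (\<forall>d\<in>arcs G. tail G d \<in> U \<longleftrightarrow> head G d \<in> U) \<longrightarrow> U = verts G)"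
proof -
  let ?H = "with_proj (mk_symmetric G)"
  interpret H: wf_digraph ?H
    by (rule wf_digraph_wp_iff[THEN iffD2]) (rule wellformed_mk_symmetric)
  have ends: "arcs_ends ?H = {(u,v). \<exists>d\<in>arcs G. {u,v} = {tail G d, head G d}}"
    unfolding arcs_ends_conv by (auto simp: parcs_mk_symmetric doubleton_eq_iff image_iff)
  have verts: "verts ?H = verts G" by simp
  show ?thesis
  proof (intro iffI conjI allI impI)
    assume conn: "Digraph_Component.connected G"
    then show "verts G \<noteq> {}" by (auto simp: connected_def strongly_connected_def)
    fix U assume U: "U \<subseteq> verts G" "U \<noteq> {}"
      and closed: "\<forall>d\<in>arcs G. tail G d \<in> U \<longleftrightarrow> head G d \<in> U"
    then obtain u where u: "u \<in> U" by auto
    have "v \<in> U" if "v \<in> verts G" for v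
    proof -
      have "u \<rightarrow>\<^sup>*\<^bsub>?H\<^esub> v"
        using conn u U that by (auto simp: connected_def strongly_connected_def)
      then show ?thesis
      proof (induct rule: H.reachable_induct)
        case (step x y)
        then obtain d where "d \<in> arcs G" "{x,y} = {tail G d, head G d}" unfolding ends by auto
        with step closed show ?case by (auto simp: doubleton_eq_iff)
      qed (rule u)
    qed
    with U show "U = verts G" by auto
  next
    assume *: "verts G \<noteq> {} \<and> (\<forall>U\<subseteq>verts G. U \<noteq> {} \<longrightarrow>
      (\<forall>d\<in>arcs G. tail G d \<in> U \<longleftrightarrow> head G d \<in> U) \<longrightarrow> U = verts G)"
    show "Digraph_Component.connected G"
      unfolding connected_def
    proof
      fix u v assume uv: "u \<in> verts ?H" "v \<in> verts ?H"
      let ?U = "{w. u \<rightarrow>\<^sup>*\<^bsub>?H\<^esub> w}"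
      have "?U = verts G"
      proof (rule *[THEN conjunct2, rule_format])
        show "?U \<subseteq> verts G" using H.reachable_in_verts(2) by auto
        show "?U \<noteq> {}" using uv(1) H.reachable_refl by blast
        fix d assume "d \<in> arcs G"
        then have "tail G d \<rightarrow>\<^bsub>?H\<^esub> head G d" "head G d \<rightarrow>\<^bsub>?H\<^esub> tail G d"
          unfolding ends by auto
        then show "tail G d \<in> ?U \<longleftrightarrow> head G d \<in> ?U"
          by (auto intro: H.reachable_adj_trans)
      qed
      with uv show "u \<rightarrow>\<^sup>*\<^bsub>?H\<^esub> v" by auto
    qed (use * in simp)
  qed
qed

lemma (in wf_digraph) boundary_of_bool:
  assumes "finite (arcs G)" "d \<in> arcs G"
  shows "boundary G (\<lambda>e. of_bool (e = d)) = delta G d"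
proof -
  have "boundary G (\<lambda>e. of_bool (e = d)) = (\<Sum>e\<in>arcs G. if e = d then delta G d else 0)"
    unfolding boundary_def by (rule sum.cong) auto
  then show ?thesis using assms by simp
qed

lemma carrier_Div0:
  "carrier (Div0 D) = {x. Poly_Mapping.keys x \<subseteq> verts D \<and> (\<Sum>w\<in>verts D. Poly_Mapping.lookup x w) = 0}"
  by (simp add: Div0_def free_Abelian_group_def)

lemma Div0_ops: "x \<otimes>\<^bsub>Div0 D\<^esub> y = x + y" "\<one>\<^bsub>Div0 D\<^esub> = 0"
  by (simp_all add: Div0_def free_Abelian_group_def)

lemma (in fin_digraph) boundary_in_Div0: "boundary G a \<in> carrier (Div0 G)"
  using sum_boundary[of "\<lambda>_. 1" a] keys_boundary by (simp add: carrier_Div0 coboundary_def)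

text \<open>
  The vertices \<open>v\<close> for which \<open>v - r\<close> is a boundary form a set that no arc leaves or enters, since
  \<open>head d - tail d\<close> is the boundary of the arc \<open>d\<close>. A divisor of degree \<open>0\<close> is a combination of
  such differences.
\<close>

lemma (in fin_digraph) range_boundary:
  assumes "Digraph_Component.connected G"
  shows "range (boundary G) = carrier (Div0 G)"
proof
  show "range (boundary G) \<subseteq> carrier (Div0 G)" using boundary_in_Div0 by auto
next
  from assms obtain r where r: "r \<in> verts G" by (auto simp: connected_iff_cuts)
  let ?U = "{v \<in> verts G. frag_of v - frag_of r \<in> range (boundary G)}"
  have "?U = verts G"
  proof (rule assms[unfolded connected_iff_cuts, THEN conjunct2, rule_format])
    show "?U \<noteq> {}" using r boundary_zero[of G] by (auto intro: rev_image_eqI)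
    fix d assume d: "d \<in> arcs G"
    let ?e = "\<lambda>e. of_bool (e = d)"
    have e: "boundary G ?e = frag_of (head G d) - frag_of (tail G d)"
      using boundary_of_bool[OF _ d] by (simp add: delta_def)
    have "boundary G a = frag_of (tail G d) - frag_of r \<Longrightarrow>
        boundary G (\<lambda>f. a f + ?e f) = frag_of (head G d) - frag_of r"
      "boundary G a = frag_of (head G d) - frag_of r \<Longrightarrow>
        boundary G (\<lambda>f. a f - ?e f) = frag_of (tail G d) - frag_of r" for a
      by (simp_all add: boundary_add boundary_diff e)
    then show "tail G d \<in> ?U \<longleftrightarrow> head G d \<in> ?U"
      using d by (auto simp: image_iff) metis+
  qed auto
  then have "\<forall>v\<in>verts G. \<exists>a. boundary G a = frag_of v - frag_of r"
    by (auto simp: image_iff set_eq_iff eq_commute)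
  then obtain a where a: "\<And>v. v \<in> verts G \<Longrightarrow> boundary G (a v) = frag_of v - frag_of r"
    by metis
  have sum_b: "boundary G (\<lambda>d. \<Sum>v\<in>W. c v * a v d) = (\<Sum>v\<in>W. frag_cmul (c v) (boundary G (a v)))"
    if "finite W" for W c
    using that by induct (simp_all add: boundary_zero boundary_add boundary_cmul)
  show "carrier (Div0 G) \<subseteq> range (boundary G)"
  proof
    fix x assume x: "x \<in> carrier (Div0 G)"
    let ?x = "Poly_Mapping.lookup x"
    have "x = (\<Sum>v\<in>verts G. frag_cmul (?x v) (frag_of v - frag_of r))"
    proof (rule poly_mapping_eqI)
      fix w
      have "?x w = 0" if "w \<notin> verts G" using x that by (auto simp: carrier_Div0 in_keys_iff)
      moreover have "(\<Sum>v\<in>verts G. ?x v) = 0" using x by (simp add: carrier_Div0)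
      ultimately show "?x w = Poly_Mapping.lookup (\<Sum>v\<in>verts G. frag_cmul (?x v) (frag_of v - frag_of r)) w"
        by (cases "w \<in> verts G")
          (simp_all add: lookup_sum lookup_minus right_diff_distrib sum_subtractf
            sum_distrib_right[symmetric] of_bool_def[symmetric])
    qed
    also have "\<dots> = boundary G (\<lambda>d. \<Sum>v\<in>verts G. ?x v * a v d)"
      by (simp add: sum_b a)
    finally show "x \<in> range (boundary G)" by blast
  qed
qed

section \<open>Spanning trees\<close>

text \<open>
  \<open>grown_tree D U B\<close> says that the arcs \<open>B\<close>, taken without their direction, form a tree with vertex
  set \<open>U\<close>. Building trees leaf by leaf makes the three facts needed about them immediate inductions:
  the number of edges, the existence of a potential with prescribed differences, and the absence of
  cycles.
\<close>

inductive grown_tree :: "('v,'d) pre_digraph \<Rightarrow> 'v set \<Rightarrow> 'd set \<Rightarrow> bool" for D where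
  root: "r \<in> verts D \<Longrightarrow> grown_tree D {r} {}"
| grow: "grown_tree D U B \<Longrightarrow> d \<in> arcs D \<Longrightarrow> {tail D d, head D d} = {u, w} \<Longrightarrow> u \<in> U \<Longrightarrow> w \<notin> U \<Longrightarrow>
    grown_tree D (insert w U) (insert d B)"

lemma grown_tree_ends:
  "grown_tree D U B \<Longrightarrow> d \<in> B \<Longrightarrow> d \<in> arcs D \<and> tail D d \<in> U \<and> head D d \<in> U"
  by (induct rule: grown_tree.induct) (auto simp: doubleton_eq_iff)

lemma (in wf_digraph) grown_tree_verts: "grown_tree G U B \<Longrightarrow> U \<noteq> {} \<and> U \<subseteq> verts G"
  by (induct rule: grown_tree.induct) (auto simp: doubleton_eq_iff)

lemma grown_tree_card:
  "grown_tree D U B \<Longrightarrow> finite U \<and> finite B \<and> card U = card B + 1"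
proof (induct rule: grown_tree.induct)
  case (grow U B d u w)
  then have "d \<notin> B" using grown_tree_ends[OF grow(1)] by (auto simp: doubleton_eq_iff)
  with grow show ?case by simp
qed simp

lemma grown_tree_potential:
  "grown_tree D U B \<Longrightarrow> \<exists>z. \<forall>d\<in>B. coboundary D z d = a d"
proof (induct rule: grown_tree.induct)
  case (grow U B d u w)
  then obtain z where z: "\<forall>d\<in>B. coboundary D z d = a d" by auto
  have uw: "u \<noteq> w" using grow by auto
  \<comment> \<open>Extend the potential over the new leaf \<open>w\<close> along \<open>d\<close>.\<close>
  let ?z = "z(w := z u + (if head D d = w then a d else - a d))"
  have "coboundary D ?z d = a d"
    using grow(4) uw by (auto simp: coboundary_def doubleton_eq_iff)
  moreover have "coboundary D ?z e = coboundary D z e" if "e \<in> B" for e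
    using grown_tree_ends[OF grow(1) that] grow(6) by (auto simp: coboundary_def)
  ultimately have "\<forall>e\<in>insert d B. coboundary D ?z e = a e" using z by simp
  then show ?case by blast
qed simp

text \<open>
  The arc added last is the only arc of the tree at its new vertex, so a cycle supported on the tree
  vanishes on it, and then it is supported on the smaller tree.
\<close>

lemma (in fin_digraph) grown_tree_acyclic:
  "grown_tree G U B \<Longrightarrow> boundary G a = 0 \<Longrightarrow> (\<And>d. d \<in> arcs G - B \<Longrightarrow> a d = 0) \<Longrightarrow>
    d \<in> arcs G \<Longrightarrow> a d = 0"
proof (induct arbitrary: d rule: grown_tree.induct)
  case (grow U B e u w)
  let ?z = "\<lambda>v. of_bool (v = w)"
  have uw: "u \<noteq> w" using grow by auto
  have others: "a f * coboundary G ?z f = 0" if "f \<in> arcs G - {e}" for f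
  proof (cases "f \<in> B")
    case True
    then show ?thesis using grown_tree_ends[OF grow(1)] grow(6) by (auto simp: coboundary_def)
  qed (use that grow in auto)
  have "(\<Sum>f\<in>arcs G. a f * coboundary G ?z f) = a e * coboundary G ?z e"
    using grow(3) sum.remove[of "arcs G" e "\<lambda>f. a f * coboundary G ?z f"]
      sum.neutral[of "arcs G - {e}" "\<lambda>f. a f * coboundary G ?z f"] others by auto
  then have "a e * coboundary G ?z e = 0" using grow(7) by (simp add: boundary_eq_0_iff)
  moreover have "coboundary G ?z e \<noteq> 0" using grow(4) uw by (auto simp: coboundary_def doubleton_eq_iff)
  ultimately have "a e = 0" by simp
  then show ?case using grow by (metis DiffE DiffI insertE)
qed simp

text \<open>
  A tree with the largest possible number of vertices cannot be extended, so its vertex set is not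
  left by any arc.
\<close>

lemma (in fin_digraph) connected_imp_grown_tree:
  assumes "Digraph_Component.connected G"
  obtains B where "grown_tree G (verts G) B"
proof -
  let ?P = "\<lambda>U. \<exists>B. grown_tree G U B"
  from assms obtain r where "r \<in> verts G" by (auto simp: connected_iff_cuts)
  then have "?P {r}" by (auto intro: grown_tree.root)
  moreover have "\<forall>U. ?P U \<longrightarrow> card U < Suc (card (verts G))"
    using grown_tree_verts card_mono[OF finite_verts] by (simp add: less_Suc_eq_le) blast
  ultimately obtain U where U: "?P U" and max: "\<And>W. ?P W \<Longrightarrow> card W \<le> card U"
    using ex_has_greatest_nat[of ?P "{r}" card "Suc (card (verts G))"] by blast
  then obtain B where B: "grown_tree G U B" by auto
  have stuck: "w \<in> U" if "d \<in> arcs G" "{tail G d, head G d} = {u, w}" "u \<in> U" for d u w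
  proof (rule ccontr)
    assume "w \<notin> U"
    with B that have "grown_tree G (insert w U) (insert d B)" by (auto intro: grown_tree.grow)
    then have "card (insert w U) \<le> card U" using max by blast
    then show False using \<open>w \<notin> U\<close> grown_tree_card[OF B] by simp
  qed
  have "\<forall>d\<in>arcs G. tail G d \<in> U \<longleftrightarrow> head G d \<in> U"
    using stuck by (metis insert_commute)
  then have "U = verts G"
    using assms grown_tree_verts[OF B] unfolding connected_iff_cuts by blast
  with B that show thesis by blast
qed

section \<open>Dual pairs of digraphs\<close>

text \<open>
  What planar duality contributes to the theorem: two connected digraphs with the same arcs such that
  the cuts of one are cycles of the other, and Euler's formula. Unlike plane graphs with their
  rotation systems, these conditions are visibly symmetric in the two digraphs.
\<close>

locale dual_digraphs = D: fin_digraph D + D': fin_digraph D'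
  for D :: "('v,'d) pre_digraph" and D' :: "('f,'d) pre_digraph" +
  assumes same_arcs: "arcs D' = arcs D"
    and connected: "Digraph_Component.connected D"
    and connected': "Digraph_Component.connected D'"
    and orthogonal: "\<And>h. boundary D (coboundary D' h) = 0"
    and euler: "card (verts D) + card (verts D') = card (arcs D) + 2"
begin

lemma swap: "dual_digraphs D' D"
proof
  fix z
  have "(\<Sum>d\<in>arcs D. coboundary D' h d * coboundary D z d) = 0" for h
    using orthogonal[of h] by (simp add: D.boundary_eq_0_iff)
  then show "boundary D' (coboundary D z) = 0"
    by (simp add: D'.boundary_eq_0_iff same_arcs mult.commute)
qed (use same_arcs connected connected' euler in auto)

text \<open>
  The complement of a spanning tree is connected in the dual. A set of dual vertices that is separated
  from the others in this complement has a cut contained in the tree. This cut is a cycle of \<open>D\<close>, and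
  the tree has only the zero cycle, so the cut is empty.
\<close>

lemma cotree_connected:
  assumes "grown_tree D (verts D) B"
  shows "Digraph_Component.connected (D'\<lparr>arcs := arcs D - B\<rparr>)"
proof -
  let ?C = "D'\<lparr>arcs := arcs D - B\<rparr>"
  interpret C: wf_digraph ?C
    by unfold_locales (auto simp: same_arcs[symmetric])
  show ?thesis
    unfolding C.connected_iff_cuts
  proof (intro conjI allI impI)
    show "verts ?C \<noteq> {}" using connected' by (auto simp: D'.connected_iff_cuts)
    fix U assume U: "U \<subseteq> verts ?C" "U \<noteq> {}"
      and closed: "\<forall>d\<in>arcs ?C. tail ?C d \<in> U \<longleftrightarrow> head ?C d \<in> U"
    let ?a = "coboundary D' (\<lambda>f. of_bool (f \<in> U))"
    have "?a d = 0" if "d \<in> arcs D - B" for d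
      using closed that by (simp add: coboundary_def)
    then have "?a d = 0" if "d \<in> arcs D" for d
      using D.grown_tree_acyclic[OF assms orthogonal] that by blast
    then have "\<forall>d\<in>arcs D'. tail D' d \<in> U \<longleftrightarrow> head D' d \<in> U"
      by (simp add: coboundary_def same_arcs of_bool_def) (metis zero_neq_one)
    then show "U = verts ?C"
      using U connected' by (simp add: D'.connected_iff_cuts)
  qed
qed

text \<open>
  By Euler's formula the complement of a spanning tree of \<open>D\<close> has exactly as many arcs as a spanning
  tree of \<open>D'\<close>; as it contains one, it is one.
\<close>

lemma tree_cotree:
  obtains B where "grown_tree D (verts D) B"
    and "grown_tree (D'\<lparr>arcs := arcs D - B\<rparr>) (verts D') (arcs D - B)"
proof -
  obtain B where B: "grown_tree D (verts D) B"
    using D.connected_imp_grown_tree[OF connected] .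
  let ?C = "D'\<lparr>arcs := arcs D - B\<rparr>"
  interpret C: fin_digraph ?C
    by unfold_locales (auto simp: same_arcs[symmetric])
  obtain B' where B': "grown_tree ?C (verts D') B'"
    using C.connected_imp_grown_tree[OF cotree_connected[OF B]] by auto
  have "B \<subseteq> arcs D" using grown_tree_ends[OF B] by auto
  then have "card (arcs D - B) = card B'"
    using euler grown_tree_card[OF B] grown_tree_card[OF B']
    by (simp add: card_Diff_subset)
  moreover have "B' \<subseteq> arcs D - B" using grown_tree_ends[OF B'] by auto
  ultimately have "B' = arcs D - B"
    by (intro card_subset_eq) auto
  with B B' that show thesis by blast
qed

text \<open>
  The values of the cycle on the cotree determine a potential on the dual vertices. The coboundary of
  the potential is itself a cycle, so the difference to the given cycle is a cycle supported on the
  tree, hence zero.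
\<close>

lemma cycle_is_dual_cut:
  assumes "boundary D a = 0"
  obtains h where "\<And>d. d \<in> arcs D \<Longrightarrow> a d = coboundary D' h d"
proof -
  obtain B where B: "grown_tree D (verts D) B"
    and B': "grown_tree (D'\<lparr>arcs := arcs D - B\<rparr>) (verts D') (arcs D - B)"
    by (rule tree_cotree)
  obtain h where "\<forall>d\<in>arcs D - B. coboundary (D'\<lparr>arcs := arcs D - B\<rparr>) h d = a d"
    using grown_tree_potential[OF B'] by blast
  then have h: "a d - coboundary D' h d = 0" if "d \<in> arcs D - B" for d
    using that by (simp add: coboundary_def)
  have "boundary D (\<lambda>d. a d - coboundary D' h d) = 0"
    by (simp add: boundary_diff assms orthogonal)
  then have "a d - coboundary D' h d = 0" if "d \<in> arcs D" for d
    using D.grown_tree_acyclic[OF B, of "\<lambda>d. a d - coboundary D' h d"] h that by blast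
  then show thesis using that by simp
qed

text \<open>
  Up to the coboundary \<open>coboundary D z\<close>, which has no boundary in \<open>D'\<close>, the chain \<open>a\<close> is a cycle of
  \<open>D\<close>, and so a cut of \<open>D'\<close>.
\<close>

lemma principal_transfer:
  assumes "boundary D a \<in> range (\<lambda>z. boundary D (coboundary D z))"
  shows "boundary D' a \<in> range (\<lambda>h. boundary D' (coboundary D' h))"
proof -
  interpret swap: dual_digraphs D' D by (rule swap)
  from assms obtain z where "boundary D a = boundary D (coboundary D z)" by auto
  then have "boundary D (\<lambda>d. a d - coboundary D z d) = 0" by (simp add: boundary_diff)
  then obtain h where h: "\<And>d. d \<in> arcs D \<Longrightarrow> a d - coboundary D z d = coboundary D' h d"
    using cycle_is_dual_cut by blast
  have "boundary D' a - boundary D' (coboundary D z) = boundary D' (coboundary D' h)"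
    unfolding boundary_diff[symmetric] by (rule boundary_cong) (simp add: h same_arcs)
  then show ?thesis by (simp add: swap.orthogonal)
qed

lemma principal_iff:
  "boundary D a \<in> range (\<lambda>z. boundary D (coboundary D z)) \<longleftrightarrow>
   boundary D' a \<in> range (\<lambda>h. boundary D' (coboundary D' h))"
  using principal_transfer dual_digraphs.principal_transfer[OF swap] by blast

end


section \<open>Correspondences between quotient groups\<close>

lemma (in group) rcos_eq_iff:
  assumes "subgroup H G" "x \<in> carrier G" "y \<in> carrier G"
  shows "H #> x = H #> y \<longleftrightarrow> x \<otimes> inv y \<in> H"
  using assms by (metis is_group rcos_self repr_independence subgroup.rcos_module)

text \<open>
  Both isomorphisms of the theorem send the class of \<open>x\<close> to the class of \<open>y\<close> whenever \<open>x\<close> and \<open>y\<close>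
  are related. For an additive relation with full domain and range, the last assumption gives both
  that the class of \<open>y\<close> is well defined and that it determines the class of \<open>x\<close>.
\<close>

lemma iso_of_quotient_correspondence:
  assumes A: "comm_group A" and B: "comm_group B"
    and P: "subgroup P A" and Q: "subgroup Q B"
    and \<rho>: "subgroup \<rho> (A \<times>\<times> B)" "fst ` \<rho> = carrier A" "snd ` \<rho> = carrier B"
    and PQ: "\<And>x y. (x, y) \<in> \<rho> \<Longrightarrow> x \<in> P \<longleftrightarrow> y \<in> Q"
  shows "(\<lambda>X. THE Y. \<exists>(x, y)\<in>\<rho>. X = P #>\<^bsub>A\<^esub> x \<and> Y = Q #>\<^bsub>B\<^esub> y) \<in> iso (A Mod P) (B Mod Q)"
    (is "?f \<in> _")
proof -
  interpret A: comm_group A by (rule A)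
  interpret B: comm_group B by (rule B)
  interpret nP: normal P A by (rule A.subgroup_imp_normal[OF P])
  interpret nQ: normal Q B by (rule B.subgroup_imp_normal[OF Q])
  have carrier: "x \<in> carrier A" "y \<in> carrier B" if "(x, y) \<in> \<rho>" for x y
    using that subgroup.subset[OF \<rho>(1)] by (auto simp: DirProd_def)
  have quot: "(x \<otimes>\<^bsub>A\<^esub> inv\<^bsub>A\<^esub> x', y \<otimes>\<^bsub>B\<^esub> inv\<^bsub>B\<^esub> y') \<in> \<rho>" if "(x, y) \<in> \<rho>" "(x', y') \<in> \<rho>" for x y x' y'
    using subgroup.m_closed[OF \<rho>(1) that(1) subgroup.m_inv_closed[OF \<rho>(1) that(2)]] carrier[OF that(2)]
    by (simp add: inv_DirProd A.is_group B.is_group)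
  have mult: "(x \<otimes>\<^bsub>A\<^esub> x', y \<otimes>\<^bsub>B\<^esub> y') \<in> \<rho>" if "(x, y) \<in> \<rho>" "(x', y') \<in> \<rho>" for x y x' y'
    using subgroup.m_closed[OF \<rho>(1) that] by simp
  have same: "P #>\<^bsub>A\<^esub> x = P #>\<^bsub>A\<^esub> x' \<longleftrightarrow> Q #>\<^bsub>B\<^esub> y = Q #>\<^bsub>B\<^esub> y'"
    if "(x, y) \<in> \<rho>" "(x', y') \<in> \<rho>" for x y x' y'
    using PQ[OF quot[OF that]] carrier[OF that(1)] carrier[OF that(2)]
    by (simp add: A.rcos_eq_iff[OF P] B.rcos_eq_iff[OF Q])
  have f: "?f (P #>\<^bsub>A\<^esub> x) = Q #>\<^bsub>B\<^esub> y" if "(x, y) \<in> \<rho>" for x y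
    using that by (intro the_equality) (auto simp: same[OF that])
  have dom: "\<exists>y. (x, y) \<in> \<rho>" if "x \<in> carrier A" for x
    using that \<rho>(2) by force
  have ran: "\<exists>x. (x, y) \<in> \<rho>" if "y \<in> carrier B" for y
    using that \<rho>(3) by force
  have cA: "carrier (A Mod P) = (\<lambda>x. P #>\<^bsub>A\<^esub> x) ` carrier A"
    by (auto simp: FactGroup_def RCOSETS_def)
  have cB: "carrier (B Mod Q) = (\<lambda>y. Q #>\<^bsub>B\<^esub> y) ` carrier B"
    by (auto simp: FactGroup_def RCOSETS_def)
  have repr: "\<exists>x y. X = P #>\<^bsub>A\<^esub> x \<and> (x, y) \<in> \<rho>" if "X \<in> carrier (A Mod P)" for X
    using that dom unfolding cA by blast
  show ?thesis
  proof (rule isoI)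
    show "?f \<in> hom (A Mod P) (B Mod Q)"
    proof (rule homI)
      fix X assume "X \<in> carrier (A Mod P)"
      then obtain x y where "X = P #>\<^bsub>A\<^esub> x" "(x, y) \<in> \<rho>" using repr by metis
      then show "?f X \<in> carrier (B Mod Q)" using f carrier unfolding cB by auto
    next
      fix X X' assume "X \<in> carrier (A Mod P)" "X' \<in> carrier (A Mod P)"
      then obtain x y x' y' where X: "X = P #>\<^bsub>A\<^esub> x" "(x, y) \<in> \<rho>"
        and X': "X' = P #>\<^bsub>A\<^esub> x'" "(x', y') \<in> \<rho>" using repr by metis
      have "X \<otimes>\<^bsub>A Mod P\<^esub> X' = P #>\<^bsub>A\<^esub> (x \<otimes>\<^bsub>A\<^esub> x')"
        using X X' carrier nP.rcos_sum by (simp add: FactGroup_def)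
      then have "?f (X \<otimes>\<^bsub>A Mod P\<^esub> X') = Q #>\<^bsub>B\<^esub> (y \<otimes>\<^bsub>B\<^esub> y')"
        by (simp only: f[OF mult[OF X(2) X'(2)]])
      also have "\<dots> = (Q #>\<^bsub>B\<^esub> y) \<otimes>\<^bsub>B Mod Q\<^esub> (Q #>\<^bsub>B\<^esub> y')"
        using X X' carrier nQ.rcos_sum by (simp add: FactGroup_def)
      also have "\<dots> = ?f X \<otimes>\<^bsub>B Mod Q\<^esub> ?f X'"
        by (simp only: X(1) X'(1) f[OF X(2)] f[OF X'(2)])
      finally show "?f (X \<otimes>\<^bsub>A Mod P\<^esub> X') = ?f X \<otimes>\<^bsub>B Mod Q\<^esub> ?f X'" .
    qed
    show "bij_betw ?f (carrier (A Mod P)) (carrier (B Mod Q))"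
    proof (rule bij_betw_imageI)
      show "inj_on ?f (carrier (A Mod P))"
      proof (rule inj_onI)
        fix X X' assume eq: "?f X = ?f X'" and "X \<in> carrier (A Mod P)" "X' \<in> carrier (A Mod P)"
        then obtain x y x' y' where X: "X = P #>\<^bsub>A\<^esub> x" "(x, y) \<in> \<rho>"
          and X': "X' = P #>\<^bsub>A\<^esub> x'" "(x', y') \<in> \<rho>" using repr by metis
        from eq have "Q #>\<^bsub>B\<^esub> y = Q #>\<^bsub>B\<^esub> y'"
          by (simp only: X(1) X'(1) f[OF X(2)] f[OF X'(2)])
        then show "X = X'" using same[OF X(2) X'(2)] X(1) X'(1) by simp
      qed
      show "?f ` carrier (A Mod P) = carrier (B Mod Q)"
      proof
        show "?f ` carrier (A Mod P) \<subseteq> carrier (B Mod Q)"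
          using repr f carrier unfolding cB by fastforce
        show "carrier (B Mod Q) \<subseteq> ?f ` carrier (A Mod P)"
        proof
          fix Y assume "Y \<in> carrier (B Mod Q)"
          then obtain y where "y \<in> carrier B" "Y = Q #>\<^bsub>B\<^esub> y" unfolding cB by auto
          then obtain x where "Y = Q #>\<^bsub>B\<^esub> y" "(x, y) \<in> \<rho>" using ran by blast
          then have "Y = ?f (P #>\<^bsub>A\<^esub> x)" "P #>\<^bsub>A\<^esub> x \<in> carrier (A Mod P)"
            using f[of x y] carrier unfolding cA by auto
          then show "Y \<in> ?f ` carrier (A Mod P)" by blast
        qed
      qed
    qed
  qed
qed

section \<open>Divisors and the Laplacian\<close>

lemma comm_group_Div0: "comm_group (Div0 D)"
proof (rule comm_groupI)
  fix x assume "x \<in> carrier (Div0 D)"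
  then have "- x \<in> carrier (Div0 D)" "- x + x = 0"
    by (simp_all add: carrier_Div0 sum_negf keys_minus)
  then show "\<exists>y\<in>carrier (Div0 D). y \<otimes>\<^bsub>Div0 D\<^esub> x = \<one>\<^bsub>Div0 D\<^esub>"
    unfolding Div0_ops by blast
qed (auto simp: carrier_Div0 Div0_ops lookup_add sum.distrib ac_simps
      dest: subsetD[OF keys_add])

lemma inv_Div0: "x \<in> carrier (Div0 D) \<Longrightarrow> inv\<^bsub>Div0 D\<^esub> x = - x"
  by (rule group.inv_equality[OF comm_group.axioms(2)[OF comm_group_Div0]])
    (simp_all add: carrier_Div0 Div0_ops sum_negf keys_minus)

lemma subgroup_Div0I:
  assumes "I \<subseteq> carrier (Div0 D)" "I \<noteq> {}" "\<And>x y. x \<in> I \<Longrightarrow> y \<in> I \<Longrightarrow> x + y \<in> I" "\<And>x. x \<in> I \<Longrightarrow> - x \<in> I"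
  shows "subgroup I (Div0 D)"
proof -
  interpret comm_group "Div0 D" by (rule comm_group_Div0)
  show ?thesis
    using assms by (intro subgroupI) (auto simp: Div0_ops inv_Div0 subset_iff)
qed

text \<open>
  Firing the vertices according to \<open>z\<close> moves \<open>z (tail d)\<close> chips along each arc \<open>d\<close>.
\<close>

lemma (in fin_digraph) laplacian_apply_eq_boundary:
  "laplacian_apply G z = boundary G (\<lambda>d. z (tail G d))"
proof (rule poly_mapping_eqI)
  fix u
  show "Poly_Mapping.lookup (laplacian_apply G z) u
    = Poly_Mapping.lookup (boundary G (\<lambda>d. z (tail G d))) u"
  proof (cases "u \<in> verts G")
    case False
    then have "Poly_Mapping.lookup (laplacian_apply G z) u = 0"
      by (auto simp: laplacian_apply_def lookup_sum intro!: sum.neutral)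
    then show ?thesis using False keys_boundary[of "\<lambda>d. z (tail G d)"] by (auto simp: in_keys_iff)
  next
    case u: True
    have in_sum: "(\<Sum>v\<in>verts G. int (num_arcs G v u) * z v)
        = (\<Sum>d\<in>arcs G. of_bool (head G d = u) * z (tail G d))"
    proof -
      have "(\<Sum>d\<in>arcs G. of_bool (head G d = u) * z (tail G d))
          = (\<Sum>v\<in>verts G. \<Sum>d\<in>{d \<in> arcs G. tail G d = v}. of_bool (head G d = u) * z (tail G d))"
        by (rule sum.group[symmetric]) auto
      also have "\<dots> = (\<Sum>v\<in>verts G. int (num_arcs G v u) * z v)"
      proof (rule sum.cong[OF refl])
        fix v
        have "(\<Sum>d\<in>{d \<in> arcs G. tail G d = v}. of_bool (head G d = u) * z (tail G d))
            = (\<Sum>d\<in>{d \<in> arcs G. tail G d = v}. of_bool (head G d = u) * z v)"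
          by (rule sum.cong) auto
        also have "\<dots> = (\<Sum>d\<in>{d \<in> arcs G. tail G d = v}. of_bool (head G d = u)) * z v"
          by (simp add: sum_distrib_right)
        also have "(\<Sum>d\<in>{d \<in> arcs G. tail G d = v}. of_bool (head G d = u)) = int (num_arcs G v u)"
          by (simp add: num_arcs_def Int_def conj_ac)
        finally show "(\<Sum>d\<in>{d \<in> arcs G. tail G d = v}. of_bool (head G d = u) * z (tail G d))
          = int (num_arcs G v u) * z v" .
      qed
      finally show ?thesis by simp
    qed
    have out_sum: "int (out_degree G u) * z u = (\<Sum>d\<in>arcs G. of_bool (tail G d = u) * z (tail G d))"
    proof -
      have "(\<Sum>d\<in>arcs G. of_bool (tail G d = u) * z (tail G d))
          = (\<Sum>d\<in>arcs G. of_bool (tail G d = u) * z u)"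
        by (rule sum.cong) auto
      then show ?thesis
        by (simp add: out_degree_def out_arcs_def Int_def flip: sum_distrib_right)
    qed
    have "Poly_Mapping.lookup (laplacian_apply G z) u = (\<Sum>v\<in>verts G. laplacian G u v * z v)"
      using u by (simp add: laplacian_apply_def lookup_sum of_bool_def[symmetric])
    also have "\<dots> = (\<Sum>v\<in>verts G. int (num_arcs G v u) * z v - (if v = u then int (out_degree G u) * z u else 0))"
      by (rule sum.cong) (auto simp: laplacian_def algebra_simps)
    also have "\<dots> = (\<Sum>d\<in>arcs G. of_bool (head G d = u) * z (tail G d))
        - (\<Sum>d\<in>arcs G. of_bool (tail G d = u) * z (tail G d))"
      using u by (simp add: sum_subtractf in_sum out_sum)
    also have "\<dots> = Poly_Mapping.lookup (boundary G (\<lambda>d. z (tail G d))) u"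
      by (simp add: boundary_def lookup_sum delta_def lookup_minus right_diff_distrib sum_subtractf
          mult.commute[of "z _"] of_bool_def eq_commute[of u])
    finally show ?thesis .
  qed
qed

lemma (in fin_digraph) subgroup_principal: "subgroup (principal G) (Div0 G)"
proof (rule subgroup_Div0I)
  show "principal G \<subseteq> carrier (Div0 G)"
    by (auto simp: principal_def laplacian_apply_eq_boundary boundary_in_Div0)
  show "x + y \<in> principal G" if "x \<in> principal G" "y \<in> principal G" for x y
    using that unfolding principal_def laplacian_apply_eq_boundary
    by (auto simp flip: boundary_add)
  show "- x \<in> principal G" if "x \<in> principal G" for x
    using that unfolding principal_def laplacian_apply_eq_boundary
    by (auto simp flip: boundary_minus)
qed (simp add: principal_def)

lemma principal_cong:
  assumes verts: "verts D = verts D'" and f: "bij_betw f (arcs D) (arcs D')"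
    and tail: "\<And>d. d \<in> arcs D \<Longrightarrow> tail D' (f d) = tail D d"
    and head: "\<And>d. d \<in> arcs D \<Longrightarrow> head D' (f d) = head D d"
  shows "principal D = principal D'"
proof -
  have "card {d \<in> arcs D. Q (tail D d) (head D d)} = card {e \<in> arcs D'. Q (tail D' e) (head D' e)}" for Q
  proof -
    have "{e \<in> arcs D'. Q (tail D' e) (head D' e)} = f ` {d \<in> arcs D. Q (tail D d) (head D d)}"
      using f tail head by (force simp: bij_betw_def)
    moreover have "inj_on f {d \<in> arcs D. Q (tail D d) (head D d)}"
      using f by (auto simp: bij_betw_def inj_on_def)
    ultimately show ?thesis by (simp add: card_image)
  qed
  from this[of "\<lambda>x y. x = _ \<and> y = _"] this[of "\<lambda>x y. x = _"]
  have "num_arcs D = num_arcs D'" "out_degree D = out_degree D'"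
    by (simp_all add: num_arcs_def out_degree_def out_arcs_def fun_eq_iff)
  then have "laplacian D = laplacian D'" by (simp add: laplacian_def fun_eq_iff)
  then show ?thesis by (simp add: principal_def laplacian_apply_def verts)
qed

lemma Div0_cong: "verts D = verts D' \<Longrightarrow> Div0 D = Div0 D'"
  by (simp add: Div0_def)

section \<open>Plane graphs as dual pairs\<close>

lemma (in bidirected_digraph) bij_arev_arcs: "bij_betw arev (arcs G) (arcs G)"
  by (rule permutes_imp_bij[OF arev_permutes_arcs])

context connected_plane_graph
begin

lemma face_succ_permutes: "face_succ M permutes arcs G"
proof -
  have "face_succ M = edge_succ M \<circ> edge_rev M" by (simp add: face_succ_def fun_eq_iff)
  then show ?thesis
    using permutes_compose[OF arev_permutes_arcs edge_succ_permutes] by simp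
qed

lemma edge_succ_in_arcs: "edge_succ M d \<in> arcs G \<longleftrightarrow> d \<in> arcs G"
  by (rule permutes_in_image[OF edge_succ_permutes])

lemma cyclic_on_face_of: "cyclic_on (face_succ M) (face_of M d)"
  unfolding face_of_def by (rule cyclic_on_orbit[OF face_succ_permutes finite_arcs])

lemma self_in_face_of: "d \<in> face_of M d"
  unfolding face_of_def
  by (rule permutation_self_in_orbit) (use face_succ_permutes finite_arcs permutation_permutes in blast)

lemma face_of_eqI: "e \<in> face_of M d \<Longrightarrow> face_of M e = face_of M d"
  using orbit_cyclic_eq3[OF cyclic_on_face_of] by (simp add: face_of_def)

lemma face_of_subset: "d \<in> arcs G \<Longrightarrow> face_of M d \<subseteq> arcs G"
  unfolding face_of_def by (rule permutes_orbit_subset[OF face_succ_permutes])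

lemma face_of_face_succ: "face_of M (face_succ M d) = face_of M d"
  by (rule face_of_eqI) (simp add: face_of_def orbit.base)

text \<open>
  The darts \<open>edge_rev M d\<close> and \<open>edge_succ M d\<close> are consecutive on the boundary of the region to the
  left of \<open>d\<close>.
\<close>

lemma face_of_edge_succ: "face_of M (edge_succ M d) = face_of M (edge_rev M d)"
  using face_of_face_succ[of "edge_rev M d"] by (simp add: face_succ_def)

lemma cyclic_on_out_arcs: "d \<in> arcs G \<Longrightarrow> cyclic_on (edge_succ M) (out_arcs G (tail G d))"
  by (rule edge_succ_cyclic) auto

lemma tail_edge_succ: "d \<in> arcs G \<Longrightarrow> tail G (edge_succ M d) = tail G d"
  using cyclic_on_inI[OF cyclic_on_out_arcs, of d d] by auto

lemma tail_face_succ: "d \<in> arcs G \<Longrightarrow> tail G (face_succ M d) = head G d"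
  by (simp add: face_succ_def tail_edge_succ)

lemma dual_graph_simps:
  "verts (dual_graph G M) = faces G M" "arcs (dual_graph G M) = arcs G"
  "tail (dual_graph G M) d = face_of M (edge_rev M d)" "head (dual_graph G M) d = face_of M d"
  by (simp_all add: dual_graph_def)

lemma fin_digraph_dual_graph: "fin_digraph (dual_graph G M)"
  by unfold_locales (auto simp: dual_graph_simps faces_def)

text \<open>
  If a set of regions is separated in the dual graph, then with one region at a vertex it contains
  all regions at this vertex, because the duals of the darts there join consecutive regions. Hence
  the vertices whose regions all lie in the set are separated from the others in \<open>G\<close>.
\<close>

lemma connected_dual_graph: "Digraph_Component.connected (dual_graph G M)"
proof -
  interpret dual: fin_digraph "dual_graph G M" by (rule fin_digraph_dual_graph)
  show ?thesis
    unfolding dual.connected_iff_cuts dual_graph_simps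
  proof (intro conjI allI impI)
    \<comment> \<open>The point with no edges violates the form of Euler's formula in use: its region has no dart.\<close>
    have "arcs G \<noteq> {}"
    proof
      assume "arcs G = {}"
      then have "faces G M = {}" "edges G M = {}" by (simp_all add: faces_def edges_def)
      moreover obtain v where "verts G = {v}"
        using connected \<open>arcs G = {}\<close> unfolding connected_iff_cuts
        by (metis (no_types, lifting) bot.extremum empty_iff ex_in_conv insert_not_empty insert_subset)
      ultimately show False using sphere by simp
    qed
    then show "faces G M \<noteq> {}" by (simp add: faces_def)
  next
    fix U assume U: "U \<subseteq> faces G M" "U \<noteq> {}"
      and "\<forall>d\<in>arcs G. face_of M (edge_rev M d) \<in> U \<longleftrightarrow> face_of M d \<in> U"
    then have closed: "face_of M (edge_rev M d) \<in> U \<longleftrightarrow> face_of M d \<in> U" if "d \<in> arcs G" for d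
      using that by blast
    \<comment> \<open>The region to the right of a dart lies at its tail, so \<open>W\<close> consists of the vertices with all regions in \<open>U\<close>.\<close>
    define W where "W = {v \<in> verts G. \<forall>d\<in>out_arcs G v. face_of M d \<in> U}"
    have around: "tail G d \<in> W \<longleftrightarrow> face_of M d \<in> U" if d: "d \<in> arcs G" for d
    proof
      assume "face_of M d \<in> U"
      have "e \<in> arcs G \<and> face_of M e \<in> U" if "e \<in> orbit (edge_succ M) d" for e
        using that
        by induct (use d \<open>face_of M d \<in> U\<close> closed in \<open>simp_all add: face_of_edge_succ edge_succ_in_arcs\<close>)
      moreover have "orbit (edge_succ M) d = out_arcs G (tail G d)"
        using orbit_cyclic_eq3[OF cyclic_on_out_arcs] d by simp
      ultimately show "tail G d \<in> W" using d by (auto simp: W_def)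
    qed (use d in \<open>auto simp: W_def\<close>)
    have "W = verts G"
    proof (rule connected[unfolded connected_iff_cuts, THEN conjunct2, rule_format])
      from U obtain d where "d \<in> arcs G" "face_of M d \<in> U" by (auto simp: faces_def)
      then show "W \<noteq> {}" using around by blast
      fix d assume d: "d \<in> arcs G"
      then show "tail G d \<in> W \<longleftrightarrow> head G d \<in> W"
        using around[of d] around[of "edge_rev M d"] closed[of d] by simp
    qed (auto simp: W_def)
    then have "face_of M d \<in> U" if "d \<in> arcs G" for d
      using that around tail_in_verts[OF that] by simp
    then show "U = faces G M" using U by (auto simp: faces_def)
  qed
qed

text \<open>
  The dual edges around a vertex form a closed curve. Here this becomes a reindexing: both
  \<open>face_succ M\<close> and \<open>edge_rev M\<close> map the darts ending in a vertex to those starting there, the first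
  keeping the region on the right and the second exchanging the two sides.
\<close>

lemma orthogonal_dual_graph:
  "(\<Sum>d\<in>arcs G. z (head G d) * (h (face_of M d) - h (face_of M (edge_rev M d)))) = (0::int)"
proof -
  have "(\<Sum>d\<in>arcs G. z (head G d) * h (face_of M d))
      = (\<Sum>d\<in>arcs G. z (tail G (face_succ M d)) * h (face_of M (face_succ M d)))"
    by (simp add: tail_face_succ face_of_face_succ)
  also have "\<dots> = (\<Sum>d\<in>arcs G. z (tail G d) * h (face_of M d))"
    by (rule sum.reindex_bij_betw[OF permutes_imp_bij[OF face_succ_permutes]])
  also have "\<dots> = (\<Sum>d\<in>arcs G. z (tail G (edge_rev M d)) * h (face_of M (edge_rev M d)))"
    by (rule sum.reindex_bij_betw[OF bij_arev_arcs, symmetric])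
  also have "\<dots> = (\<Sum>d\<in>arcs G. z (head G d) * h (face_of M (edge_rev M d)))"
    by simp
  finally show ?thesis by (simp add: right_diff_distrib sum_subtractf)
qed

end

text \<open>
  Choosing one dart \<open>d\<close> of each edge makes a chain an arbitrary function on \<open>S\<close>, with no
  antisymmetry condition, and the edges of \<open>G\<close> become the arcs of a digraph.
\<close>

locale oriented_plane_graph = connected_plane_graph G M
  for G :: "('v,'d) pre_digraph" and M :: "'d pre_map" +
  fixes S :: "'d set"
  assumes orientation: "orientation G M S"
begin

lemma S_subset: "S \<subseteq> arcs G"
  using orientation by (simp add: orientation_def)

lemma S_in_arcs: "d \<in> S \<Longrightarrow> d \<in> arcs G"
  using S_subset by auto

lemma edge_rev_in_S_iff: "d \<in> arcs G \<Longrightarrow> edge_rev M d \<in> S \<longleftrightarrow> d \<notin> S"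
proof -
  assume d: "d \<in> arcs G"
  then have "\<exists>!e. e \<in> {d, edge_rev M d} \<and> e \<in> S"
    using orientation by (auto simp: orientation_def edges_def)
  then show ?thesis using arev_neq[OF d] by auto
qed

lemma sum_arcs_orientation:
  fixes f :: "'d \<Rightarrow> 'a::comm_monoid_add"
  shows "(\<Sum>d\<in>arcs G. f d) = (\<Sum>d\<in>S. f d + f (edge_rev M d))"
proof -
  have "arcs G = S \<union> edge_rev M ` S" and "S \<inter> edge_rev M ` S = {}"
    using edge_rev_in_S_iff S_subset by (auto simp: image_iff) (metis arev_arev)+
  moreover have "finite S" using S_subset finite_arcs by (rule finite_subset)
  ultimately have "(\<Sum>d\<in>arcs G. f d) = (\<Sum>d\<in>S. f d) + (\<Sum>d\<in>edge_rev M ` S. f d)"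
    by (simp add: sum.union_disjoint)
  then show ?thesis by (simp add: sum.reindex inj_on_arev sum.distrib)
qed

lemma card_edges: "card (edges G M) = card S"
proof -
  have "edges G M = (\<lambda>d. {d, edge_rev M d}) ` S"
  proof
    show "edges G M \<subseteq> (\<lambda>d. {d, edge_rev M d}) ` S"
    proof
      fix k assume "k \<in> edges G M"
      then obtain d where d: "d \<in> arcs G" "k = {d, edge_rev M d}" by (auto simp: edges_def)
      then have "k = {edge_rev M d, edge_rev M (edge_rev M d)}" by auto
      then show "k \<in> (\<lambda>d. {d, edge_rev M d}) ` S" using d edge_rev_in_S_iff by blast
    qed
  qed (use S_subset in \<open>auto simp: edges_def\<close>)
  moreover have "inj_on (\<lambda>d. {d, edge_rev M d}) S"
    by (rule inj_onI) (metis S_in_arcs doubleton_eq_iff edge_rev_in_S_iff)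
  ultimately show ?thesis by (simp add: card_image)
qed

abbreviation "D \<equiv> G\<lparr>arcs := S\<rparr>"
abbreviation "D' \<equiv> dual_graph G M\<lparr>arcs := S\<rparr>"

lemma fin_digraph_D: "fin_digraph D"
  using S_in_arcs finite_subset[OF S_subset finite_arcs] by unfold_locales auto

lemma fin_digraph_D': "fin_digraph D'"
  using S_in_arcs finite_subset[OF S_subset finite_arcs]
  by unfold_locales (auto simp: dual_graph_simps faces_def)

lemma connected_orientation:
  assumes "wf_digraph H" and H: "arcs H = arcs G" "\<And>d. d \<in> arcs G \<Longrightarrow> tail H (edge_rev M d) = head H d"
    "\<And>d. d \<in> arcs G \<Longrightarrow> head H (edge_rev M d) = tail H d"
    and conn: "Digraph_Component.connected H"
  shows "Digraph_Component.connected (H\<lparr>arcs := S\<rparr>)"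
proof -
  interpret H: wf_digraph H by fact
  interpret S: wf_digraph "H\<lparr>arcs := S\<rparr>" by unfold_locales (auto simp: H(1) S_in_arcs)
  show ?thesis
    unfolding S.connected_iff_cuts
  proof (intro conjI allI impI)
    fix U assume U: "U \<subseteq> verts (H\<lparr>arcs := S\<rparr>)" "U \<noteq> {}"
      and "\<forall>d\<in>arcs (H\<lparr>arcs := S\<rparr>). tail (H\<lparr>arcs := S\<rparr>) d \<in> U \<longleftrightarrow> head (H\<lparr>arcs := S\<rparr>) d \<in> U"
    then have "tail H d \<in> U \<longleftrightarrow> head H d \<in> U" if "d \<in> S" for d using that by simp
    then have "tail H d \<in> U \<longleftrightarrow> head H d \<in> U" if "d \<in> arcs G" for d
      using that edge_rev_in_S_iff H by metis
    then show "U = verts (H\<lparr>arcs := S\<rparr>)" using conn U by (simp add: H.connected_iff_cuts H(1))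
  qed (use conn in \<open>simp add: H.connected_iff_cuts\<close>)
qed

text \<open>
  The two opposite darts of an edge have opposite boundaries, so the contributions
  \<open>z (tail d)\<close> and \<open>z (head d)\<close> combine to a coboundary. The sign disappears in the range.
\<close>

lemma principal_orientation:
  assumes "fin_digraph H" and H: "arcs H = arcs G" "\<And>d. d \<in> arcs G \<Longrightarrow> tail H (edge_rev M d) = head H d"
    "\<And>d. d \<in> arcs G \<Longrightarrow> head H (edge_rev M d) = tail H d"
  shows "principal H = range (\<lambda>z. boundary (H\<lparr>arcs := S\<rparr>) (coboundary (H\<lparr>arcs := S\<rparr>) z))"
proof -
  interpret H: fin_digraph H by fact
  have *: "laplacian_apply H z = boundary (H\<lparr>arcs := S\<rparr>) (coboundary (H\<lparr>arcs := S\<rparr>) (\<lambda>v. - z v))" for z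
  proof -
    have "laplacian_apply H z = (\<Sum>d\<in>S. frag_cmul (z (tail H d)) (delta H d)
        + frag_cmul (z (tail H (edge_rev M d))) (delta H (edge_rev M d)))"
      unfolding H.laplacian_apply_eq_boundary by (simp add: boundary_def H(1) sum_arcs_orientation)
    also have "\<dots> = (\<Sum>d\<in>S. frag_cmul (z (tail H d) - z (head H d)) (delta H d))"
    proof (rule sum.cong[OF refl])
      fix d assume "d \<in> S"
      then have "tail H (edge_rev M d) = head H d" "delta H (edge_rev M d) = - delta H d"
        using H S_in_arcs by (auto simp: delta_def)
      then show "frag_cmul (z (tail H d)) (delta H d)
        + frag_cmul (z (tail H (edge_rev M d))) (delta H (edge_rev M d))
        = frag_cmul (z (tail H d) - z (head H d)) (delta H d)"
        by (intro poly_mapping_eqI) (simp add: lookup_add algebra_simps)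
    qed
    finally show ?thesis by (simp add: boundary_def coboundary_def delta_def)
  qed
  have surj: "surj (\<lambda>z v. - z v :: int)" by (rule surjI[of _ "\<lambda>z v. - z v"]) simp
  show ?thesis
    unfolding principal_def *
    using image_image[of "\<lambda>z. boundary (H\<lparr>arcs := S\<rparr>) (coboundary (H\<lparr>arcs := S\<rparr>) z)" "\<lambda>z v. - z v" UNIV]
    by (simp only: surj)
qed

lemma dual_digraphs: "dual_digraphs D D'"
proof -
  interpret D: fin_digraph D by (rule fin_digraph_D)
  interpret D': fin_digraph D' by (rule fin_digraph_D')
  show ?thesis
  proof
    show "Digraph_Component.connected D"
      by (rule connected_orientation) (unfold_locales, simp_all add: connected)
    show "Digraph_Component.connected D'"
      using fin_digraph_dual_graph connected_dual_graph
      by (intro connected_orientation) (simp_all add: fin_digraph_def dual_graph_simps)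
    show "card (verts D) + card (verts D') = card (arcs D) + 2"
      using sphere by (simp add: card_edges dual_graph_simps)
    fix h :: "'d set \<Rightarrow> int"
    let ?k = "\<lambda>d. h (face_of M d) - h (face_of M (edge_rev M d))"
    have "(\<Sum>d\<in>S. ?k d * (z (head G d) - z (tail G d))) = (\<Sum>d\<in>arcs G. z (head G d) * ?k d)" for z
      unfolding sum_arcs_orientation by (rule sum.cong) (auto simp: S_in_arcs algebra_simps)
    then show "boundary D (coboundary D' h) = 0"
      by (simp add: D.boundary_eq_0_iff coboundary_def dual_graph_simps orthogonal_dual_graph)
  qed simp
qed

text \<open>
  The graph of the correspondence on divisors. It is the central object: \<open>dual_iso\<close> is defined by
  it, and it is also what white triangle equivalence expresses.
\<close>

definition duality_relation :: "(('v \<Rightarrow>\<^sub>0 int) \<times> ('d set \<Rightarrow>\<^sub>0 int)) set" where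
  "duality_relation = range (\<lambda>a. (boundary D a, boundary D' a))"

lemma dual_iso_eq:
  "dual_iso G M S = (\<lambda>X. THE Y. \<exists>(x, y)\<in>duality_relation.
     X = principal G #>\<^bsub>Div0 G\<^esub> x \<and> Y = principal (dual_graph G M) #>\<^bsub>Div0 (dual_graph G M)\<^esub> y)"
proof -
  have "Div0 D = Div0 G" by (rule Div0_cong) simp
  then have "boundary D a \<in> carrier (Div0 G)" for a
    using fin_digraph.boundary_in_Div0[OF fin_digraph_D, of a] by simp
  moreover have "delta D = delta G" "delta D' = delta (dual_graph G M)"
    by (simp_all add: delta_def fun_eq_iff)
  ultimately show ?thesis
    unfolding dual_iso_def duality_relation_def pic_class_def[symmetric]
    by (intro ext arg_cong[of _ _ The]) (auto simp: boundary_def)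
qed

lemma dual_iso_iso: "dual_iso G M S \<in> iso (Pic0 G) (Pic0 (dual_graph G M))"
proof -
  interpret dual_digraphs D D' by (rule dual_digraphs)
  interpret dual: fin_digraph "dual_graph G M" by (rule fin_digraph_dual_graph)
  have Div0: "Div0 D = Div0 G" "Div0 D' = Div0 (dual_graph G M)" by (rule Div0_cong, simp)+
  have P: "principal G = range (\<lambda>z. boundary D (coboundary D z))"
    by (rule principal_orientation) (unfold_locales, simp_all)
  have P': "principal (dual_graph G M) = range (\<lambda>z. boundary D' (coboundary D' z))"
    by (rule principal_orientation) (simp_all add: fin_digraph_dual_graph dual_graph_simps)
  show ?thesis
    unfolding dual_iso_eq Pic0_def
  proof (rule iso_of_quotient_correspondence)
    show "fst ` duality_relation = carrier (Div0 G)"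
      using D.range_boundary[OF connected] by (simp add: Div0 duality_relation_def image_image)
    show "snd ` duality_relation = carrier (Div0 (dual_graph G M))"
      using D'.range_boundary[OF connected'] by (simp add: Div0 duality_relation_def image_image)
    show "x \<in> principal G \<longleftrightarrow> y \<in> principal (dual_graph G M)" if "(x, y) \<in> duality_relation" for x y
    proof -
      obtain a where "x = boundary D a" "y = boundary D' a"
        using \<open>(x, y) \<in> duality_relation\<close> by (auto simp: duality_relation_def)
      then show ?thesis unfolding P P' by (simp only: principal_iff)
    qed
    interpret A: comm_group "Div0 G" by (rule comm_group_Div0)
    interpret B: comm_group "Div0 (dual_graph G M)" by (rule comm_group_Div0)
    interpret AB: group "Div0 G \<times>\<times> Div0 (dual_graph G M)"
      by (intro DirProd_group A.is_group B.is_group)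
    have rel: "boundary D a \<in> carrier (Div0 G)" "boundary D' a \<in> carrier (Div0 (dual_graph G M))" for a
      using D.boundary_in_Div0 D'.boundary_in_Div0 by (simp_all add: Div0)
    show "subgroup duality_relation (Div0 G \<times>\<times> Div0 (dual_graph G M))"
    proof (rule AB.subgroupI)
      show "duality_relation \<subseteq> carrier (Div0 G \<times>\<times> Div0 (dual_graph G M))"
        using rel by (auto simp: duality_relation_def)
      show "inv\<^bsub>Div0 G \<times>\<times> Div0 (dual_graph G M)\<^esub> p \<in> duality_relation" if "p \<in> duality_relation" for p
        using that rel unfolding duality_relation_def
        by (auto simp: inv_DirProd A.is_group B.is_group inv_Div0 simp flip: boundary_minus)
      show "p \<otimes>\<^bsub>Div0 G \<times>\<times> Div0 (dual_graph G M)\<^esub> q \<in> duality_relation"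
        if "p \<in> duality_relation" "q \<in> duality_relation" for p q
        using that rel unfolding duality_relation_def
        by (auto simp: Div0_ops simp flip: boundary_add)
    qed (simp add: duality_relation_def)
  qed (rule comm_group_Div0 subgroup_principal dual.subgroup_principal)+
qed

end


section \<open>The trinity of a plane graph\<close>

text \<open>
  The darts around each node of the trinity alternate between two kinds. Each kind is indexed by a
  cycle of darts of \<open>G\<close>: those around a vertex, the two of an edge, or those bounding a region.
\<close>

lemma cyclic_on_interleave:
  assumes g: "cyclic_on g C"
    and f: "\<And>c. c \<in> C \<Longrightarrow> f (p c) = q c" "\<And>c. c \<in> C \<Longrightarrow> f (q c) = p (g c)"
  shows "cyclic_on f (p ` C \<union> q ` C)"
proof -
  from g obtain c where c: "c \<in> C" "C = orbit g c" unfolding cyclic_on_def by auto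
  have "p e \<in> orbit f (p c) \<and> q e \<in> orbit f (p c)" if "e \<in> orbit g c" for e
    using that
  proof induct
    case base
    have "p (g c) = f (f (p c))" "q (g c) = f (p (g c))"
      using f c cyclic_on_inI[OF g] by auto
    then show ?case by (metis orbit.base orbit.step)
  next
    case (step e)
    then have "p (g e) = f (q e)" "q (g e) = f (p (g e))"
      using f c cyclic_on_inI[OF g] by auto
    with step show ?case by (metis orbit.step)
  qed
  moreover have "e \<in> p ` C \<union> q ` C" if "e \<in> orbit f (p c)" for e
    using that
    by induct (use c f cyclic_on_inI[OF g] in \<open>auto intro: rev_image_eqI\<close>)
  ultimately have "orbit f (p c) = p ` C \<union> q ` C" using c by auto
  then show ?thesis using c unfolding cyclic_on_def by auto
qed

lemma orbit_three_cycle: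
  assumes "f x = y" "f y = z" "f z = x"
  shows "orbit f x = {x, y, z}"
proof
  show "orbit f x \<subseteq> {x, y, z}"
  proof
    fix w assume "w \<in> orbit f x"
    then show "w \<in> {x, y, z}" by induct (use assms in auto)
  qed
  show "{x, y, z} \<subseteq> orbit f x"
    using assms by (metis empty_subsetI insert_subset orbit.base orbit.step)
qed

lemma orbit_two_cycle:
  assumes "f x = y" "f y = x"
  shows "orbit f x = {x, y}"
proof
  show "orbit f x \<subseteq> {x, y}"
  proof
    fix w assume "w \<in> orbit f x"
    then show "w \<in> {x, y}" by induct (use assms in auto)
  qed
  show "{x, y} \<subseteq> orbit f x"
    using assms by (metis empty_subsetI insert_subset orbit.base orbit.step)
qed

context oriented_plane_graph
begin

abbreviation "T \<equiv> trinity_graph G M"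
abbreviation "N \<equiv> trinity_map G M"

abbreviation black_triangle :: "'d \<Rightarrow> 'd tdart set" where
  "black_triangle d \<equiv> {VE d, ER d, RV d}"

abbreviation white_triangle :: "'d \<Rightarrow> 'd tdart set" where
  "white_triangle d \<equiv> {EV d, VR (edge_succ M d), RE (edge_rev M d)}"

lemma arcs_T [simp]:
  "VE d \<in> arcs T \<longleftrightarrow> d \<in> arcs G" "EV d \<in> arcs T \<longleftrightarrow> d \<in> arcs G"
  "VR d \<in> arcs T \<longleftrightarrow> d \<in> arcs G" "RV d \<in> arcs T \<longleftrightarrow> d \<in> arcs G"
  "ER d \<in> arcs T \<longleftrightarrow> d \<in> arcs G" "RE d \<in> arcs T \<longleftrightarrow> d \<in> arcs G"
  by (auto simp: trinity_graph_def)

lemma verts_T: "verts T = V_node ` verts G \<union> E_node ` edges G M \<union> R_node ` faces G M"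
  by (simp add: trinity_graph_def)

lemma tail_T [simp]: "tail T = trinity_tail G M"
  by (simp add: trinity_graph_def)

lemma head_T: "head T k = trinity_tail G M (trinity_rev k)"
  by (simp add: trinity_graph_def)

lemma trinity_rev_in_arcs: "trinity_rev k \<in> arcs T \<longleftrightarrow> k \<in> arcs T"
  by (cases k) auto

lemma edge_rev_N: "edge_rev N k = (if k \<in> arcs T then trinity_rev k else k)"
  by (simp add: trinity_map_def perm_restrict_def)

lemma edge_succ_N: "edge_succ N k = (if k \<in> arcs T then trinity_succ M k else k)"
  by (simp add: trinity_map_def perm_restrict_def)

lemma inv_face_succ_in_arcs: "inv_into UNIV (face_succ M) d \<in> arcs G \<longleftrightarrow> d \<in> arcs G"
  by (rule permutes_in_image[OF permutes_inv[OF face_succ_permutes]])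

lemma edge_succ_eq_iff: "edge_succ M d = edge_succ M e \<longleftrightarrow> d = e"
  using permutes_inj[OF edge_succ_permutes] by (auto dest: injD)

lemma trinity_tail_in_verts: "k \<in> arcs T \<Longrightarrow> trinity_tail G M k \<in> verts T"
  by (cases k) (auto simp: verts_T edges_def faces_def)

lemma fin_digraph_T: "fin_digraph T"
proof
  show "tail T k \<in> verts T" "head T k \<in> verts T" if "k \<in> arcs T" for k
    using that trinity_tail_in_verts by (simp_all add: head_T trinity_rev_in_arcs)
  show "finite (arcs T)" by (simp add: trinity_graph_def)
  show "finite (verts T)" by (simp add: verts_T edges_def faces_def)
qed

lemma bidirected_digraph_T: "bidirected_digraph T (edge_rev N)"
proof -
  interpret T: fin_digraph T by (rule fin_digraph_T)
  have "trinity_rev k \<noteq> k" "trinity_rev (trinity_rev k) = k" for k :: "'d tdart" by (cases k; simp)+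
  then show ?thesis
    by unfold_locales (simp_all add: edge_rev_N trinity_rev_in_arcs head_T)
qed

lemma edge_succ_N_permutes: "edge_succ N permutes arcs T"
proof -
  interpret T: fin_digraph T by (rule fin_digraph_T)
  have "inj_on (edge_succ N) (arcs T)"
  proof (rule inj_onI)
    fix k l assume "k \<in> arcs T" "l \<in> arcs T" "edge_succ N k = edge_succ N l"
    then have "trinity_succ M k = trinity_succ M l" by (simp add: edge_succ_N)
    then show "k = l"
      by (cases k; cases l)
        (auto simp: edge_succ_eq_iff arev_eq_iff dest: injD[OF permutes_inj[OF permutes_inv[OF face_succ_permutes]]])
  qed
  moreover have "edge_succ N ` arcs T \<subseteq> arcs T"
  proof
    fix k assume "k \<in> edge_succ N ` arcs T"
    then obtain l where "l \<in> arcs T" "k = trinity_succ M l" by (auto simp: edge_succ_N)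
    then show "k \<in> arcs T" by (cases l) (auto simp: edge_succ_in_arcs inv_face_succ_in_arcs)
  qed
  ultimately have "bij_betw (edge_succ N) (arcs T) (arcs T)"
    by (simp add: bij_betw_def endo_inj_surj)
  then show ?thesis by (rule bij_imp_permutes) (simp add: edge_succ_N)
qed

lemma tail_eq_V_iff: "k \<in> arcs T \<and> trinity_tail G M k = V_node v \<longleftrightarrow> k \<in> VR ` out_arcs G v \<union> VE ` out_arcs G v"
  by (cases k) auto

lemma tail_eq_E_iff:
  assumes "e \<in> edges G M"
  shows "k \<in> arcs T \<and> trinity_tail G M k = E_node e \<longleftrightarrow> k \<in> EV ` e \<union> ER ` e"
  using assms by (cases k) (auto simp: edges_def doubleton_eq_iff)

lemma tail_eq_R_iff:
  assumes "f \<in> faces G M"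
  shows "k \<in> arcs T \<and> trinity_tail G M k = R_node f \<longleftrightarrow> k \<in> RE ` f \<union> RV ` f"
proof -
  obtain d where d: "d \<in> arcs G" "f = face_of M d" using assms by (auto simp: faces_def)
  have "e \<in> arcs G \<and> face_of M e = f \<longleftrightarrow> e \<in> f" for e
    using d face_of_subset[OF d(1)] face_of_eqI self_in_face_of by auto
  then show ?thesis by (cases k) auto
qed

lemma edge_succ_N_cyclic:
  assumes "n \<in> verts T" "out_arcs T n \<noteq> {}"
  shows "cyclic_on (edge_succ N) (out_arcs T n)"
proof -
  have "cyclic_on (trinity_succ M) (out_arcs T n)"
  proof (cases n)
    case (V_node v)
    then have out: "out_arcs T n = VR ` out_arcs G v \<union> VE ` out_arcs G v"
      using tail_eq_V_iff[of _ v] by (auto simp: out_arcs_def)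
    have "cyclic_on (edge_succ M) (out_arcs G v)"
      using assms V_node unfolding out by (intro edge_succ_cyclic) (auto simp: verts_T)
    then show ?thesis unfolding out by (rule cyclic_on_interleave) simp_all
  next
    case (E_node e)
    then have e: "e \<in> edges G M" using assms by (auto simp: verts_T)
    then have out: "out_arcs T n = EV ` e \<union> ER ` e"
      using E_node tail_eq_E_iff[OF e] by (auto simp: out_arcs_def)
    obtain d where "d \<in> arcs G" "e = {d, edge_rev M d}" using e by (auto simp: edges_def)
    then have "orbit (edge_rev M) d = e"
      by (simp add: orbit_two_cycle)
    then have "cyclic_on (edge_rev M) e"
      using \<open>e = _\<close> unfolding cyclic_on_def by auto
    then show ?thesis unfolding out by (rule cyclic_on_interleave) simp_all
  next
    case (R_node f)
    then have f: "f \<in> faces G M" using assms by (auto simp: verts_T)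
    then have out: "out_arcs T n = RE ` f \<union> RV ` f"
      using R_node tail_eq_R_iff[OF f] by (auto simp: out_arcs_def)
    obtain d where d: "d \<in> arcs G" "f = face_of M d" using f by (auto simp: faces_def)
    have "permutation (face_succ M)"
      using face_succ_permutes finite_arcs permutation_permutes by blast
    then have "orbit (inv_into UNIV (face_succ M)) d = f"
      using d by (simp add: face_of_def orbit_inv_eq)
    then have "cyclic_on (inv_into UNIV (face_succ M)) f"
      using d self_in_face_of unfolding cyclic_on_def by auto
    then show ?thesis unfolding out by (rule cyclic_on_interleave) simp_all
  qed
  then show ?thesis
    by (subst cyclic_cong[of _ _ "trinity_succ M"]) (auto simp: edge_succ_N)
qed

text \<open>
  Every emerald and every red node is adjacent to a violet one, and two adjacent vertices of \<open>G\<close>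
  share the emerald node on the edge between them.
\<close>

lemma connected_T: "Digraph_Component.connected T"
proof -
  interpret T: fin_digraph T by (rule fin_digraph_T)
  show ?thesis
    unfolding T.connected_iff_cuts
  proof (intro conjI allI impI)
    show "verts T \<noteq> {}" using connected by (auto simp: verts_T connected_iff_cuts)
    fix U assume U: "U \<subseteq> verts T" "U \<noteq> {}"
      and "\<forall>k\<in>arcs T. tail T k \<in> U \<longleftrightarrow> head T k \<in> U"
    then have closed: "k \<in> arcs T \<Longrightarrow> trinity_tail G M k \<in> U \<longleftrightarrow> trinity_tail G M (trinity_rev k) \<in> U" for k
      by (simp add: head_T)
    have E: "E_node {d, edge_rev M d} \<in> U \<longleftrightarrow> V_node (tail G d) \<in> U"
      and R: "R_node (face_of M d) \<in> U \<longleftrightarrow> V_node (tail G d) \<in> U" if "d \<in> arcs G" for d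
      using closed[of "EV d"] closed[of "RV d"] that by simp_all
    let ?W = "{v \<in> verts G. V_node v \<in> U}"
    have "?W = verts G"
    proof (rule connected[unfolded connected_iff_cuts, THEN conjunct2, rule_format])
      obtain n where n: "n \<in> U" "n \<in> verts T" using U by auto
      show "?W \<noteq> {}"
      proof (cases n)
        case (E_node e)
        then obtain d where "d \<in> arcs G" "e = {d, edge_rev M d}" using n by (auto simp: verts_T edges_def)
        then have "tail G d \<in> ?W" using E n E_node by simp
        then show ?thesis by blast
      next
        case (R_node f)
        then obtain d where "d \<in> arcs G" "f = face_of M d" using n by (auto simp: verts_T faces_def)
        then have "tail G d \<in> ?W" using R n R_node by simp
        then show ?thesis by blast
      qed (use n in \<open>auto simp: verts_T\<close>)
      fix d assume d: "d \<in> arcs G"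
      then have "V_node (tail G d) \<in> U \<longleftrightarrow> V_node (head G d) \<in> U"
        using E[of d] E[of "edge_rev M d"] by (simp add: insert_commute)
      then show "tail G d \<in> ?W \<longleftrightarrow> head G d \<in> ?W" using d by simp
    qed auto
    then have "V_node v \<in> U" if "v \<in> verts G" for v using that by blast
    then show "U = verts T"
      using U E R by (auto simp: verts_T edges_def faces_def)
  qed
qed

lemma edges_T: "edges T N = (\<lambda>d. {VE d, EV d}) ` arcs G \<union> (\<lambda>d. {VR d, RV d}) ` arcs G
    \<union> (\<lambda>d. {ER d, RE d}) ` arcs G"
proof
  show "edges T N \<subseteq> (\<lambda>d. {VE d, EV d}) ` arcs G \<union> (\<lambda>d. {VR d, RV d}) ` arcs G
    \<union> (\<lambda>d. {ER d, RE d}) ` arcs G"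
  proof
    fix e assume "e \<in> edges T N"
    then obtain k where "k \<in> arcs T" "e = {k, trinity_rev k}" by (auto simp: edges_def edge_rev_N)
    then show "e \<in> (\<lambda>d. {VE d, EV d}) ` arcs G \<union> (\<lambda>d. {VR d, RV d}) ` arcs G
      \<union> (\<lambda>d. {ER d, RE d}) ` arcs G"
      by (cases k) (auto simp: insert_commute)
  qed
  have "{k, trinity_rev k} \<in> edges T N" if "k \<in> arcs T" for k
    using that by (auto simp: edges_def edge_rev_N)
  from this[of "VE _"] this[of "VR _"] this[of "ER _"]
  show "(\<lambda>d. {VE d, EV d}) ` arcs G \<union> (\<lambda>d. {VR d, RV d}) ` arcs G
    \<union> (\<lambda>d. {ER d, RE d}) ` arcs G \<subseteq> edges T N" by auto
qed

lemma face_succ_N: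
  assumes "d \<in> arcs G"
  shows "face_succ N (VE d) = ER d" "face_succ N (ER d) = RV d" "face_succ N (RV d) = VE d"
    "face_succ N (EV d) = VR (edge_succ M d)"
    "face_succ N (VR (edge_succ M d)) = RE (edge_rev M d)" "face_succ N (RE (edge_rev M d)) = EV d"
proof -
  have "inv_into UNIV (face_succ M) (edge_succ M d) = edge_rev M d"
    using permutes_inverses(2)[OF face_succ_permutes, of "edge_rev M d"] by (simp add: face_succ_def)
  then show "face_succ N (VE d) = ER d" "face_succ N (ER d) = RV d" "face_succ N (RV d) = VE d"
    "face_succ N (EV d) = VR (edge_succ M d)"
    "face_succ N (VR (edge_succ M d)) = RE (edge_rev M d)" "face_succ N (RE (edge_rev M d)) = EV d"
    using assms by (simp_all add: face_succ_def edge_rev_N edge_succ_N edge_succ_in_arcs)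
qed

lemma face_of_N:
  assumes "d \<in> arcs G"
  shows "face_of N (VE d) = black_triangle d" "face_of N (ER d) = black_triangle d"
    "face_of N (RV d) = black_triangle d"
    "face_of N (EV d) = white_triangle d" "face_of N (VR (edge_succ M d)) = white_triangle d"
    "face_of N (RE (edge_rev M d)) = white_triangle d"
  unfolding face_of_def
  using face_succ_N[OF assms] orbit_three_cycle[of "face_succ N"] by (simp_all add: insert_commute)

text \<open>
  Each dart \<open>d\<close> of \<open>G\<close> cuts out two triangles at the half edge at its tail: the black one on its
  right and the white one on its left.
\<close>

lemma faces_T: "faces T N = black_triangle ` arcs G \<union> white_triangle ` arcs G"
proof
  show "faces T N \<subseteq> black_triangle ` arcs G \<union> white_triangle ` arcs G"
  proof
    fix t assume "t \<in> faces T N"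
    then obtain k where k: "k \<in> arcs T" "t = face_of N k" by (auto simp: faces_def)
    show "t \<in> black_triangle ` arcs G \<union> white_triangle ` arcs G"
    proof (cases k)
      case (VR d)
      define e where "e = inv_into UNIV (edge_succ M) d"
      have "d = edge_succ M e"
        by (simp add: e_def permutes_inverses(1)[OF edge_succ_permutes])
      with VR k have "e \<in> arcs G" "t = white_triangle e"
        using edge_succ_in_arcs[of e] face_of_N(5)[of e] by simp_all
      then show ?thesis by blast
    next
      case (RE d)
      then have "edge_rev M d \<in> arcs G" "t = white_triangle (edge_rev M d)"
        using k face_of_N(6)[of "edge_rev M d"] by simp_all
      then show ?thesis by blast
    qed (use k face_of_N in auto)
  qed
  have "face_of N k \<in> faces T N" if "k \<in> arcs T" for k using that by (simp add: faces_def)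
  from this[of "VE _"] this[of "EV _"]
  show "black_triangle ` arcs G \<union> white_triangle ` arcs G \<subseteq> faces T N"
    by (auto simp: face_of_N)
qed

lemma black_triangle_inject: "black_triangle d = black_triangle e \<longleftrightarrow> d = e"
proof
  assume "black_triangle d = black_triangle e"
  then have "VE d \<in> black_triangle e" by blast
  then show "d = e" by simp
qed simp

lemma white_triangle_inject: "white_triangle d = white_triangle e \<longleftrightarrow> d = e"
proof
  assume "white_triangle d = white_triangle e"
  then have "EV d \<in> white_triangle e" by blast
  then show "d = e" by simp
qed simp

lemma black_neq_white_triangle: "black_triangle d \<noteq> white_triangle e"
proof
  assume "black_triangle d = white_triangle e"
  then have "VE d \<in> white_triangle e" by blast
  then show False by simp
qed

text \<open>
  With \<open>n\<close> edges in \<open>G\<close>, there are \<open>2n\<close> darts, giving \<open>6n\<close> edges and \<open>4n\<close> triangles, while the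
  number of points is \<open>2n + 2\<close> by Euler's formula for \<open>G\<close>.
\<close>

lemma sphere_T: "card (verts T) + card (faces T N) = card (edges T N) + 2"
proof -
  have "card (arcs G) = 2 * card (edges G M)"
    using sum_arcs_orientation[of "\<lambda>_. 1::nat"] by (simp add: card_edges)
  moreover have "card (verts T) = card (verts G) + card (edges G M) + card (faces G M)"
  proof -
    have fin: "finite (edges G M)" "finite (faces G M)" by (simp_all add: edges_def faces_def)
    have "card (V_node ` verts G \<union> E_node ` edges G M) = card (verts G) + card (edges G M)"
      using fin by (subst card_Un_disjoint) (auto simp: card_image inj_on_def)
    then show ?thesis
      unfolding verts_T using fin by (subst card_Un_disjoint) (auto simp: card_image inj_on_def)
  qed
  moreover have "card (edges T N) = 3 * card (arcs G)"
  proof -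
    let ?VE = "\<lambda>d. {VE d, EV d}" and ?VR = "\<lambda>d. {VR d, RV d}" and ?ER = "\<lambda>d. {ER d, RE d}"
    have inj: "inj_on ?VE (arcs G)" "inj_on ?VR (arcs G)" "inj_on ?ER (arcs G)"
      by (auto simp: inj_on_def doubleton_eq_iff)
    have disj: "?VE ` arcs G \<inter> ?VR ` arcs G = {}" "(?VE ` arcs G \<union> ?VR ` arcs G) \<inter> ?ER ` arcs G = {}"
      by (auto simp: doubleton_eq_iff)
    show ?thesis
      by (simp add: edges_T card_Un_disjoint disj card_image inj)
  qed
  moreover have "card (faces T N) = 2 * card (arcs G)"
  proof -
    have "inj_on black_triangle (arcs G)" "inj_on white_triangle (arcs G)"
      using black_triangle_inject white_triangle_inject by (auto intro!: inj_onI)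
    moreover have "black_triangle ` arcs G \<inter> white_triangle ` arcs G = {}"
      using black_neq_white_triangle by auto
    ultimately show ?thesis by (simp add: faces_T card_Un_disjoint card_image)
  qed
  ultimately show ?thesis using sphere by simp
qed

lemma trinity_T: "trinity T N"
proof -
  interpret T: fin_digraph T by (rule fin_digraph_T)
  interpret T: bidirected_digraph T "edge_rev N" by (rule bidirected_digraph_T)
  show ?thesis
  proof
    show "node_color (tail T k) \<noteq> node_color (head T k)" for k
      by (cases k) (simp_all add: head_T)
    show "card t = 3" if "t \<in> faces T N" for t
      using that by (auto simp: faces_T)
  qed (fact edge_succ_N_permutes edge_succ_N_cyclic connected_T sphere_T)+
qed

lemma white_triangles_T: "white_triangles T N = white_triangle ` arcs G"
proof -
  define white where "white t \<longleftrightarrow> (\<exists>k\<in>t. node_color (tail T k) = Red \<and>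
      node_color (tail T (face_succ N k)) = Emerald \<and>
      node_color (tail T (face_succ N (face_succ N k))) = Violet)" for t
  have black: "\<not> white (black_triangle d)" if "d \<in> arcs G" for d
    using that by (simp add: white_def face_succ_N)
  have white: "white (white_triangle d)" if "d \<in> arcs G" for d
    using that by (simp add: white_def face_succ_N)
  have "{t \<in> B ` arcs G \<union> W ` arcs G. white t} = W ` arcs G"
    if "\<And>d. d \<in> arcs G \<Longrightarrow> \<not> white (B d)" "\<And>d. d \<in> arcs G \<Longrightarrow> white (W d)" for B W
    using that by blast
  from this[OF black white] show ?thesis
    unfolding white_triangles_def faces_T white_def .
qed

lemma black_triangles_T: "black_triangles T N = black_triangle ` arcs G"
  by (auto simp: black_triangles_def white_triangles_T faces_T)

lemma white_triangle_at_T: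
  assumes "d \<in> arcs G"
  shows "white_triangle_at T N {ER d, RE d} = white_triangle (edge_rev M d)"
    "white_triangle_at T N {VE d, EV d} = white_triangle d"
  unfolding white_triangle_at_def white_triangles_T
  using assms by (auto intro!: the_equality intro: rev_image_eqI)

lemma black_triangle_at_T:
  assumes "d \<in> arcs G"
  shows "black_triangle_at T N {ER d, RE d} = black_triangle d"
    "black_triangle_at T N {VE d, EV d} = black_triangle d"
  unfolding black_triangle_at_def black_triangles_T
  using assms by (auto intro!: the_equality)

lemma tails_white_triangle:
  assumes "d \<in> arcs G"
  shows "trinity_tail G M ` white_triangle d =
    {V_node (tail G d), E_node {d, edge_rev M d}, R_node (face_of M (edge_rev M d))}"
  using assms by (auto simp: tail_edge_succ)

lemma node_white_triangle:
  assumes "d \<in> arcs G"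
  shows "violet_node T (white_triangle d) = tail G d"
    "red_node T (white_triangle d) = face_of M (edge_rev M d)"
  unfolding violet_node_def red_node_def tail_T tails_white_triangle[OF assms] by simp_all

lemma node_black_triangle:
  "violet_node T (black_triangle d) = tail G d" "red_node T (black_triangle d) = face_of M d"
  by (simp_all add: violet_node_def red_node_def)

lemma colored_edges_T:
  "colored_edges T N Violet = (\<lambda>d. {ER d, RE d}) ` arcs G"
  "colored_edges T N Red = (\<lambda>d. {VE d, EV d}) ` arcs G"
  by (auto simp: colored_edges_def edges_T)

lemma verts_D_V: "verts (D_V T N) = verts G"
  by (auto simp: D_V_def verts_T)

lemma verts_D_R: "verts (D_R T N) = faces G M"
  by (auto simp: D_R_def verts_T)

text \<open>
  The violet edge at the right of \<open>d\<close> has the black triangle at the tail of \<open>d\<close> and the white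
  triangle at the head of \<open>d\<close> on its sides, so it plays the role of \<open>d\<close> in \<open>D_V\<close>.
\<close>

lemma principal_D_V: "principal (D_V T N) = principal G"
proof (rule principal_cong[symmetric])
  show "bij_betw (\<lambda>d. {ER d, RE d}) (arcs G) (arcs (D_V T N))"
    by (auto simp: bij_betw_def inj_on_def D_V_def colored_edges_T doubleton_eq_iff)
  show "verts G = verts (D_V T N)" by (simp only: verts_D_V)
  fix d assume d: "d \<in> arcs G"
  then show "tail (D_V T N) {ER d, RE d} = tail G d"
    by (simp add: D_V_def black_triangle_at_T node_black_triangle)
  show "head (D_V T N) {ER d, RE d} = head G d"
    using d node_white_triangle(1)[of "edge_rev M d"] by (simp add: D_V_def white_triangle_at_T)
qed

text \<open>
  The arc of \<open>D_R\<close> given by the half edge at the tail of \<open>d\<close> leads from the region on the right of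
  \<open>d\<close> to the one on its left, that is, against the dual of \<open>d\<close>. Therefore the dual of \<open>d\<close> is matched
  with the other half of the edge.
\<close>

lemma principal_D_R: "principal (D_R T N) = principal (dual_graph G M)"
proof (rule principal_cong[symmetric])
  have "bij_betw (\<lambda>d. {VE d, EV d}) (arcs G) (arcs (D_R T N))"
    by (auto simp: bij_betw_def inj_on_def D_R_def colored_edges_T doubleton_eq_iff)
  from bij_betw_trans[OF bij_arev_arcs this]
  show "bij_betw (\<lambda>d. {VE (edge_rev M d), EV (edge_rev M d)}) (arcs (dual_graph G M)) (arcs (D_R T N))"
    by (simp add: o_def dual_graph_simps)
  show "verts (dual_graph G M) = verts (D_R T N)" by (simp only: verts_D_R dual_graph_simps)
  fix d assume "d \<in> arcs (dual_graph G M)"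
  then have d: "d \<in> arcs G" by (simp add: dual_graph_simps)
  then show "tail (D_R T N) {VE (edge_rev M d), EV (edge_rev M d)} = tail (dual_graph G M) d"
    by (simp add: D_R_def black_triangle_at_T node_black_triangle dual_graph_simps)
  show "head (D_R T N) {VE (edge_rev M d), EV (edge_rev M d)} = head (dual_graph G M) d"
    using d node_white_triangle(2)[of "edge_rev M d"]
    by (simp add: D_R_def white_triangle_at_T dual_graph_simps)
qed

lemma Div0_D_V: "Div0 (D_V T N) = Div0 G"
  by (rule Div0_cong) (rule verts_D_V)

lemma Div0_D_R: "Div0 (D_R T N) = Div0 (dual_graph G M)"
  by (rule Div0_cong) (simp add: verts_D_R dual_graph_simps)

lemma Pic0_D_V: "Pic0 (D_V T N) = Pic0 G"
  by (simp add: Pic0_def Div0_D_V principal_D_V)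

lemma Pic0_D_R: "Pic0 (D_R T N) = Pic0 (dual_graph G M)"
  by (simp add: Pic0_def Div0_D_R principal_D_R)

end

section \<open>White triangles and planar duality\<close>

lemma frag_cmul_add_minus: "frag_cmul k x + frag_cmul (- k) y = frag_cmul (- k) (y - x)"
  by (intro poly_mapping_eqI) (simp add: lookup_add lookup_minus right_diff_distrib)

lemma lookup_frag_extend_of:
  assumes "inj f"
  shows "Poly_Mapping.lookup (frag_extend (frag_of \<circ> f) x) (f v) = Poly_Mapping.lookup x v"
proof -
  have "Poly_Mapping.lookup (frag_extend (frag_of \<circ> f) x) (f v)
      = (\<Sum>i\<in>Poly_Mapping.keys x. if i = v then Poly_Mapping.lookup x i else 0)"
    unfolding frag_extend_def lookup_sum
    by (rule sum.cong) (use injD[OF assms] in auto)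
  then show ?thesis by (simp add: in_keys_iff)
qed

lemma lookup_frag_extend_of_other:
  "w \<notin> range f \<Longrightarrow> Poly_Mapping.lookup (frag_extend (frag_of \<circ> f) x) w = 0"
  unfolding frag_extend_def lookup_sum by (rule sum.neutral) auto

lemma lookup_triple:
  "Poly_Mapping.lookup (triple x y z) (V_node v) = Poly_Mapping.lookup x v"
  "Poly_Mapping.lookup (triple x y z) (E_node e) = Poly_Mapping.lookup y e"
  "Poly_Mapping.lookup (triple x y z) (R_node r) = Poly_Mapping.lookup z r"
  using lookup_frag_extend_of[of V_node] lookup_frag_extend_of[of E_node] lookup_frag_extend_of[of R_node]
  by (simp_all add: triple_def lookup_add inj_def lookup_frag_extend_of_other image_iff)

lemma triple_eq_iff: "triple x y z = triple x' y' z' \<longleftrightarrow> x = x' \<and> y = y' \<and> z = z'"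
  by (metis lookup_triple poly_mapping_eqI)

lemma triple_diff: "triple x y z - triple x' y' z' = triple (x - x') (y - y') (z - z')"
  by (simp add: triple_def frag_extend_diff)

lemma triple_sum:
  "triple (\<Sum>d\<in>A. frag_cmul (c d) (frag_of (f d))) (\<Sum>d\<in>A. frag_cmul (c d) (frag_of (g d)))
     (\<Sum>d\<in>A. frag_cmul (c d) (frag_of (h d)))
   = (\<Sum>d\<in>A. frag_cmul (c d) (frag_of (V_node (f d)) + frag_of (E_node (g d)) + frag_of (R_node (h d))))"
  by (cases "finite A")
    (simp_all add: triple_def frag_extend_sum frag_extend_cmul frag_cmul_distrib2 sum.distrib)

context oriented_plane_graph
begin

lemma inj_on_white_triangle: "inj_on white_triangle (arcs G)"
  using white_triangle_inject by (auto intro!: inj_onI)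

text \<open>
  White triangles correspond to darts, so their coefficients can be indexed by darts; then the three
  components are compared separately.
\<close>

lemma white_triangle_equiv_iff_sum:
  "white_triangle_equiv T N (triple x 0 0) (triple 0 0 (- y)) \<longleftrightarrow>
    (\<exists>c. x = (\<Sum>d\<in>arcs G. frag_cmul (c d) (frag_of (tail G d))) \<and>
      (\<Sum>d\<in>arcs G. frag_cmul (c d) (frag_of {d, edge_rev M d})) = 0 \<and>
      y = (\<Sum>d\<in>arcs G. frag_cmul (c d) (frag_of (face_of M (edge_rev M d)))))"
    (is "?L \<longleftrightarrow> (\<exists>c. ?R c)")
proof -
  have tails: "(\<Sum>n\<in>tail T ` white_triangle d. frag_of n)
      = frag_of (V_node (tail G d)) + frag_of (E_node {d, edge_rev M d})
        + frag_of (R_node (face_of M (edge_rev M d)))" if "d \<in> arcs G" for d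
    unfolding tail_T tails_white_triangle[OF that] by (simp add: add.assoc)
  have sum: "(\<Sum>t\<in>white_triangles T N. frag_cmul (c t) (\<Sum>n\<in>tail T ` t. frag_of n))
      = (\<Sum>d\<in>arcs G. frag_cmul (c (white_triangle d)) (frag_of (V_node (tail G d))
        + frag_of (E_node {d, edge_rev M d}) + frag_of (R_node (face_of M (edge_rev M d)))))" for c
    unfolding white_triangles_T sum.reindex[OF inj_on_white_triangle]
    by (rule sum.cong) (simp_all only: o_apply tails)
  have diff: "triple x 0 0 - triple 0 0 (- y) = triple x 0 y" by (simp add: triple_diff)
  have "?L \<longleftrightarrow> (\<exists>c. ?R (\<lambda>d. c (white_triangle d)))"
    unfolding white_triangle_equiv_def diff sum triple_sum[symmetric] triple_eq_iff
    by (simp add: eq_commute[of 0])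
  also have "\<dots> \<longleftrightarrow> (\<exists>c. ?R c)"
  proof
    assume "\<exists>c. ?R c"
    then obtain c where "?R c" ..
    then have "?R (\<lambda>d. (c \<circ> inv_into (arcs G) white_triangle) (white_triangle d))"
      by (simp add: inv_into_f_f[OF inj_on_white_triangle])
    then show "\<exists>c. ?R (\<lambda>d. c (white_triangle d))" by blast
  next
    assume "\<exists>c. ?R (\<lambda>d. c (white_triangle d))"
    then obtain c where "?R (\<lambda>d. c (white_triangle d))" ..
    then show "\<exists>c. ?R c" by (rule exI[of ?R "\<lambda>d. c (white_triangle d)"])
  qed
  finally show ?thesis .
qed

text \<open>
  The emerald node of an edge lies on exactly two white triangles, those of its two darts.
\<close>

lemma emerald_sum_eq_0_iff:
  "(\<Sum>d\<in>arcs G. frag_cmul (c d) (frag_of {d, edge_rev M d})) = 0 \<longleftrightarrow>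
    (\<forall>d\<in>arcs G. c (edge_rev M d) = - c d)" (is "?sum = 0 \<longleftrightarrow> _")
proof -
  have at: "Poly_Mapping.lookup ?sum {e, edge_rev M e} = c e + c (edge_rev M e)" if "e \<in> arcs G" for e
  proof -
    have "Poly_Mapping.lookup ?sum {e, edge_rev M e}
        = (\<Sum>d\<in>arcs G. if d \<in> {e, edge_rev M e} then c d else 0)"
      unfolding lookup_sum by (rule sum.cong) (auto simp: doubleton_eq_iff)
    also have "\<dots> = (\<Sum>d\<in>{e, edge_rev M e}. c d)"
      using that by (intro sum.mono_neutral_cong_right) auto
    also have "\<dots> = c e + c (edge_rev M e)"
      using arev_neq[OF that] by simp
    finally show ?thesis .
  qed
  show ?thesis
  proof
    assume "?sum = 0"
    then show "\<forall>d\<in>arcs G. c (edge_rev M d) = - c d"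
      using at by (metis add_eq_0_iff lookup_zero)
  next
    assume anti: "\<forall>d\<in>arcs G. c (edge_rev M d) = - c d"
    show "?sum = 0"
    proof (rule poly_mapping_eqI)
      fix e
      show "Poly_Mapping.lookup ?sum e = Poly_Mapping.lookup 0 e"
      proof (cases "e \<in> edges G M")
        case True
        then show ?thesis using at anti by (auto simp: edges_def)
      next
        case False
        then show ?thesis by (auto simp: lookup_sum edges_def intro!: sum.neutral)
      qed
    qed
  qed
qed

text \<open>
  If the coefficients of the white triangles of \<open>d\<close> and \<open>edge_rev M d\<close> are opposite, the two triangles
  together contribute a multiple of \<open>head d - tail d\<close> plus the boundary of the dual of \<open>d\<close>.
\<close>

lemma duality_relation_iff:
  "(x, y) \<in> duality_relation \<longleftrightarrow> white_triangle_equiv T N (triple x 0 0) (triple 0 0 (- y))"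
proof -
  have bd: "(\<Sum>d\<in>arcs G. frag_cmul (c d) (frag_of (tail G d))) = boundary D (\<lambda>d. - c d)"
    "(\<Sum>d\<in>arcs G. frag_cmul (c d) (frag_of (face_of M (edge_rev M d)))) = boundary D' (\<lambda>d. - c d)"
    if anti: "\<forall>d\<in>arcs G. c (edge_rev M d) = - c d" for c
  proof -
    have anti_S: "c (edge_rev M d) = - c d" if "d \<in> S" for d
      using anti S_in_arcs[OF that] by simp
    show "(\<Sum>d\<in>arcs G. frag_cmul (c d) (frag_of (tail G d))) = boundary D (\<lambda>d. - c d)"
      unfolding sum_arcs_orientation boundary_def
    proof (rule sum.cong)
      fix d assume "d \<in> arcs D"
      then have "d \<in> S" by simp
      then have "tail G (edge_rev M d) = head G d" using S_in_arcs by simp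
      then show "frag_cmul (c d) (frag_of (tail G d))
          + frag_cmul (c (edge_rev M d)) (frag_of (tail G (edge_rev M d))) = frag_cmul (- c d) (delta D d)"
        by (simp only: anti_S[OF \<open>d \<in> S\<close>] frag_cmul_add_minus) (simp add: delta_def)
    qed simp
    show "(\<Sum>d\<in>arcs G. frag_cmul (c d) (frag_of (face_of M (edge_rev M d)))) = boundary D' (\<lambda>d. - c d)"
      unfolding sum_arcs_orientation boundary_def
    proof (rule sum.cong)
      fix d assume "d \<in> arcs D'"
      then have "d \<in> S" by simp
      then show "frag_cmul (c d) (frag_of (face_of M (edge_rev M d)))
          + frag_cmul (c (edge_rev M d)) (frag_of (face_of M (edge_rev M (edge_rev M d))))
          = frag_cmul (- c d) (delta D' d)"
        by (simp only: anti_S[OF \<open>d \<in> S\<close>] frag_cmul_add_minus arev_arev)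
          (simp add: delta_def dual_graph_simps)
    qed simp
  qed
  show ?thesis
    unfolding white_triangle_equiv_iff_sum emerald_sum_eq_0_iff
  proof
    assume "(x, y) \<in> duality_relation"
    then obtain a where a: "x = boundary D a" "y = boundary D' a" by (auto simp: duality_relation_def)
    \<comment> \<open>The triangle of \<open>d\<close> contains the tail of \<open>d\<close>, which has the negative sign in its boundary.\<close>
    define c where "c d = (if d \<in> S then - a d else a (edge_rev M d))" for d
    have anti: "\<forall>d\<in>arcs G. c (edge_rev M d) = - c d" by (simp add: c_def edge_rev_in_S_iff)
    have "boundary D (\<lambda>d. - c d) = x" "boundary D' (\<lambda>d. - c d) = y"
      unfolding a by (rule boundary_cong; simp add: c_def)+
    then show "\<exists>c. x = (\<Sum>d\<in>arcs G. frag_cmul (c d) (frag_of (tail G d))) \<and>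
      (\<forall>d\<in>arcs G. c (edge_rev M d) = - c d) \<and>
      y = (\<Sum>d\<in>arcs G. frag_cmul (c d) (frag_of (face_of M (edge_rev M d))))"
      using anti by (intro exI[of _ c] conjI) (simp_all only: bd[OF anti])
  next
    assume "\<exists>c. x = (\<Sum>d\<in>arcs G. frag_cmul (c d) (frag_of (tail G d))) \<and>
      (\<forall>d\<in>arcs G. c (edge_rev M d) = - c d) \<and>
      y = (\<Sum>d\<in>arcs G. frag_cmul (c d) (frag_of (face_of M (edge_rev M d))))"
    then obtain c where anti: "\<forall>d\<in>arcs G. c (edge_rev M d) = - c d"
      and "x = (\<Sum>d\<in>arcs G. frag_cmul (c d) (frag_of (tail G d)))"
      and "y = (\<Sum>d\<in>arcs G. frag_cmul (c d) (frag_of (face_of M (edge_rev M d))))"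
      by blast
    then have "x = boundary D (\<lambda>d. - c d)" "y = boundary D' (\<lambda>d. - c d)"
      by (simp_all only: bd[OF anti])
    then show "(x, y) \<in> duality_relation"
      unfolding duality_relation_def by blast
  qed
qed

lemma phi_VR_eq_dual_iso: "phi_VR T N = dual_iso G M S"
proof -
  have rel: "x \<in> carrier (Div0 G)" "y \<in> carrier (Div0 (dual_graph G M))"
    if "(x, y) \<in> duality_relation" for x y
  proof -
    obtain a where "x = boundary D a" "y = boundary D' a" using \<open>(x, y) \<in> duality_relation\<close> by (auto simp: duality_relation_def)
    moreover have "Div0 D = Div0 G" "Div0 D' = Div0 (dual_graph G M)" by (rule Div0_cong, simp)+
    ultimately show "x \<in> carrier (Div0 G)" "y \<in> carrier (Div0 (dual_graph G M))"
      using fin_digraph.boundary_in_Div0[OF fin_digraph_D, of a]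
        fin_digraph.boundary_in_Div0[OF fin_digraph_D', of a] by simp_all
  qed
  show ?thesis
    unfolding phi_VR_def[abs_def] dual_iso_eq duality_relation_iff[symmetric] pic_class_def
      Div0_D_V Div0_D_R principal_D_V principal_D_R
    by (intro ext arg_cong[of _ _ The]) (use rel in blast)
qed

end

theorem proposition3p7:
  fixes G :: "('v,'d) pre_digraph" and M :: "'d pre_map" and S :: "'d set"
  assumes "connected_plane_graph G M"
    and "arcs G \<noteq> {}"
    and "orientation G M S"
  shows "trinity (trinity_graph G M) (trinity_map G M)
    \<and> Pic0 (D_V (trinity_graph G M) (trinity_map G M)) = Pic0 G
    \<and> Pic0 (D_R (trinity_graph G M) (trinity_map G M)) = Pic0 (dual_graph G M)
    \<and> phi_VR (trinity_graph G M) (trinity_map G M)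
        \<in> iso (Pic0 (D_V (trinity_graph G M) (trinity_map G M)))
              (Pic0 (D_R (trinity_graph G M) (trinity_map G M)))
    \<and> dual_iso G M S \<in> iso (Pic0 G) (Pic0 (dual_graph G M))
    \<and> (\<forall>X\<in>carrier (Pic0 G).
        phi_VR (trinity_graph G M) (trinity_map G M) X = dual_iso G M S X)"
proof -
  interpret oriented_plane_graph G M S
    using assms by (simp add: oriented_plane_graph_def oriented_plane_graph_axioms_def)
  show ?thesis
    using trinity_T dual_iso_iso by (simp add: Pic0_D_V Pic0_D_R phi_VR_eq_dual_iso)
qed

end
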